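(* Let $\mathcal{Q}=(Q,I)$ be a locally gentle quiver, with corresponding algebra $A=KQ/I$. Then the determinant of the $q$-Cartan matrix is $$\det C_{\mathcal{Q}}(q) = \det C_{A}(q) = \frac{\prod_{C\in\mathcal{ZC}(\mathcal{Q})} \bigl(1-(-q)^{l(C)}\bigr)}{\prod_{C\in\mathcal{IC}(\mathcal{Q})} \bigl(1-q^{l(C)}\bigr)}.$$
   Context: A quiver $Q$ is a directed graph with finitely many vertices (set $Q_0$) and finitely many arrows (set $Q_1$); loops and multiple arrows are allowed. For a path $p$, $s(p)$ and $t(p)$ are its start and end vertices; paths are written from left to right, so in the path algebra $KQ$ over a field $K$ the product $pq$ is the concatenation if $t(p)=s(q)$ and $0$ otherwise. For each vertex $i$ there is a trivial path $e_i$ of length $0$. An ideal $I\subseteq KQ$ is admissible if it is contained in the square of the ideal generated by the arrows. Locally gentle quiver: a pair $(Q,I)$ with $I$ an admissible ideal of $KQ$ such that: (G2) each vertex of $Q$ is the starting point of at most two arrows and the end point of at most two arrows; (G3) for each arrow $\alpha$ there is at most one arrow $\beta$ such that $\alpha\beta\notin I$, and at most one arrow $\gamma$ such that $\gamma\alpha\notin I$; (G4) $I$ is generated by paths of length $2$; (G5) for each arrow $\alpha$ there is at most one arrow $\beta'$ with $t(\alpha)=s(\beta')$ and $\alpha\beta'\in I$, and at most one arrow $\gamma'$ with $t(\gamma')=s(\alpha)$ and $\gamma'\alpha\in I$. $q$-Cartan matrix: $A=KQ/I$ is graded by path length (arrows in degree $1$). Let $q$ be an indeterminate. The $q$-Cartan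 matrix $C_{\mathcal{Q}}(q)=C_A(q)=(c_{ij}(q))_{i,j\in Q_0}$ has entries $c_{ij}(q)=\sum_n \dim_K (e_iAe_j)_n\,q^n\in\mathbb{Z}[[q]]$; equivalently, $c_{ij}(q)$ counts each path from $i$ to $j$ of length $n$ that is non-zero in $A$ by $q^n$. Cycles: a (minimal) oriented cycle with full relations is a closed path $C=\alpha_1\cdots\alpha_l$ ($l\ge1$) with pairwise distinct arrows such that $\alpha_i\alpha_{i+1}\in I$ for all $i$ (indices mod $l$); a (minimal) oriented cycle with no relations is a closed path $C=\alpha_1\cdots\alpha_l$ ($l\ge 1$) with pairwise distinct arrows such that $\alpha_i\alpha_{i+1}\notin I$ for all $i$ (indices mod $l$). Cycles are considered up to cyclic rotation, and $l(C)=l$ is the length. $\mathcal{ZC}(\mathcal{Q})$ and $\mathcal{IC}(\mathcal{Q})$ denote the sets of minimal oriented cycles with full relations and with no relations, respectively. *)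

theory Defs
  imports
    "Graph_Theory.Graph_Theory"
    "Jordan_Normal_Form.Determinant"
    "HOL-Algebra.Embedded_Algebras"
    "HOL-Algebra.Ideal_Product"
    "HOL-Algebra.QuotRing"
    "HOL-Computational_Algebra.Formal_Power_Series"
    "HOL-Computational_Algebra.Polynomial_Factorial"
begin

text \<open>
  A quiver is a finite directed multigraph, i.e. a \<^locale>\<open>fin_digraph\<close> (loops and multiple
  arrows are allowed). A path is a pair of its start vertex and its list of arrows, read from
  left to right; \<open>(i, [])\<close> is the trivial path at \<open>i\<close>.
\<close>

type_synonym ('v, 'a) path = "'v \<times> 'a list"

definition paths :: "('v, 'a) pre_digraph \<Rightarrow> ('v, 'a) path set" where
  "paths Q = {(u, p). \<exists>v. pre_digraph.awalk Q u p v}"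

definition path_source :: "('v, 'a) path \<Rightarrow> 'v" where
  "path_source x = fst x"

definition path_target :: "('v, 'a) pre_digraph \<Rightarrow> ('v, 'a) path \<Rightarrow> 'v" where
  "path_target Q x = pre_digraph.awlast Q (fst x) (snd x)"

definition path_length :: "('v, 'a) path \<Rightarrow> nat" where
  "path_length x = length (snd x)"

definition path_concat :: "('v, 'a) path \<Rightarrow> ('v, 'a) path \<Rightarrow> ('v, 'a) path" where
  "path_concat x y = (fst x, snd x @ snd y)"

text \<open>
  The path algebra: finitely supported functions from the paths to the field \<open>'k\<close>. The
  multiplication is the bilinear extension of concatenation (zero if the paths do not compose),
  and the unit is the sum of the trivial paths.
\<close>

definition scalar_elem :: "('v, 'a) pre_digraph \<Rightarrow> 'k \<Rightarrow> ('v, 'a) path \<Rightarrow> 'k::field" where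
  "scalar_elem Q c = (\<lambda>(u, p). if u \<in> verts Q \<and> p = [] then c else 0)"

definition path_algebra :: "('v, 'a) pre_digraph \<Rightarrow> (('v, 'a) path \<Rightarrow> 'k::field) ring" where
  "path_algebra Q =
     \<lparr>carrier = {f. finite {x. f x \<noteq> 0} \<and> {x. f x \<noteq> 0} \<subseteq> paths Q},
      mult = (\<lambda>f g x. \<Sum>y | f y \<noteq> 0. \<Sum>z | g z \<noteq> 0.
                if path_target Q y = path_source z \<and> path_concat y z = x then f y * g z else 0),
      one = scalar_elem Q 1,
      zero = (\<lambda>x. 0),
      add = (\<lambda>f g x. f x + g x)\<rparr>"

lemma path_algebra_mult_nth:
  assumes Q: "wf_digraph Q"
    and f: "f \<in> carrier (path_algebra Q)" and g: "g \<in> carrier (path_algebra Q)"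
  shows "(f \<otimes>\<^bsub>path_algebra Q\<^esub> g) (u, p) =
    (\<Sum>k\<le>length p. f (u, take k p) * g (pre_digraph.awlast Q u (take k p), drop k p))"
proof -
  interpret wf_digraph Q by fact
  have fin: "finite {y. f y \<noteq> 0}" "finite {z. g z \<noteq> 0}"
    using f g by (auto simp: path_algebra_def)
  let ?P = "\<lambda>(y, z). path_target Q y = path_source z \<and> path_concat y z = (u, p)"
  let ?h = "\<lambda>k. ((u, take k p), (awlast u (take k p), drop k p))"
  have "(f \<otimes>\<^bsub>path_algebra Q\<^esub> g) (u, p) =
     (\<Sum>w \<in> {y. f y \<noteq> 0} \<times> {z. g z \<noteq> 0}. if ?P w then f (fst w) * g (snd w) else 0)"
    by (simp add: path_algebra_def sum.cartesian_product split_beta)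
  also have "\<dots> = (\<Sum>w \<in> {w \<in> {y. f y \<noteq> 0} \<times> {z. g z \<noteq> 0}. ?P w}. f (fst w) * g (snd w))"
    using fin by (intro sum.inter_filter[symmetric]) auto
  also have "\<dots> = (\<Sum>w \<in> ?h ` {..length p}. f (fst w) * g (snd w))"
  proof (rule sum.mono_neutral_left)
    show "{w \<in> {y. f y \<noteq> 0} \<times> {z. g z \<noteq> 0}. ?P w} \<subseteq> ?h ` {..length p}"
    proof
      fix w assume "w \<in> {w \<in> {y. f y \<noteq> 0} \<times> {z. g z \<noteq> 0}. ?P w}"
      then have "w = ?h (length (snd (fst w)))" "length (snd (fst w)) \<le> length p"
        by (cases w, auto simp: path_target_def path_source_def path_concat_def)+
      then show "w \<in> ?h ` {..length p}" by blast
    qed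
  qed (auto simp: path_target_def path_source_def path_concat_def)
  also have "\<dots> = (\<Sum>k\<le>length p. f (u, take k p) * g (awlast u (take k p), drop k p))"
  proof (subst sum.reindex)
    show "inj_on ?h {..length p}"
      by (rule inj_onI) (metis Pair_inject atMost_iff length_take min.absorb2)
  qed auto
  finally show ?thesis .
qed

lemma awlast_append:
  "pre_digraph.awlast Q (pre_digraph.awlast Q u p) q = pre_digraph.awlast Q u (p @ q)"
  by (simp add: pre_digraph.awalk_verts_conv)

lemma path_algebra_mult_closed:
  assumes Q: "wf_digraph Q"
    and f: "f \<in> carrier (path_algebra Q)" and g: "g \<in> carrier (path_algebra Q)"
  shows "f \<otimes>\<^bsub>path_algebra Q\<^esub> g \<in> carrier (path_algebra Q)"
proof -
  interpret wf_digraph Q by fact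
  let ?m = "f \<otimes>\<^bsub>path_algebra Q\<^esub> g"
  have fin: "finite {y. f y \<noteq> 0}" "finite {z. g z \<noteq> 0}"
    and sub: "\<And>x. f x \<noteq> 0 \<Longrightarrow> x \<in> paths Q" "\<And>x. g x \<noteq> 0 \<Longrightarrow> x \<in> paths Q"
    using f g by (auto simp: path_algebra_def)
  have *: "\<exists>y z. f y \<noteq> 0 \<and> g z \<noteq> 0 \<and> path_target Q y = path_source z \<and> path_concat y z = x"
    if nz: "?m x \<noteq> 0" for x
  proof -
    obtain u p where x: "x = (u, p)" by (cases x)
    from nz obtain k where "k \<le> length p"
      "f (u, take k p) * g (awlast u (take k p), drop k p) \<noteq> 0"
      unfolding x path_algebra_mult_nth[OF Q f g]
      using sum.not_neutral_contains_not_neutral by blast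
    then show ?thesis
      unfolding x
      by (intro exI[of _ "(u, take k p)"] exI[of _ "(awlast u (take k p), drop k p)"])
         (auto simp: path_target_def path_source_def path_concat_def)
  qed
  have "{x. ?m x \<noteq> 0} \<subseteq> (\<lambda>(y, z). path_concat y z) ` ({y. f y \<noteq> 0} \<times> {z. g z \<noteq> 0})"
  proof
    fix x assume "x \<in> {x. ?m x \<noteq> 0}"
    then obtain y z where "f y \<noteq> 0" "g z \<noteq> 0" "path_concat y z = x"
      using *[of x] by blast
    then show "x \<in> (\<lambda>(y, z). path_concat y z) ` ({y. f y \<noteq> 0} \<times> {z. g z \<noteq> 0})"
      by (intro image_eqI[of _ _ "(y, z)"]) auto
  qed
  then have 1: "finite {x. ?m x \<noteq> 0}"
    by (rule finite_subset) (use fin in auto)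
  have 2: "x \<in> paths Q" if nz: "?m x \<noteq> 0" for x
  proof -
    from *[OF nz] obtain y z where yz: "f y \<noteq> 0" "g z \<noteq> 0"
      "path_target Q y = path_source z" "path_concat y z = x" by blast
    from sub(1)[OF yz(1)] obtain v where a: "awalk (fst y) (snd y) v" by (auto simp: paths_def)
    from sub(2)[OF yz(2)] obtain w where b: "awalk (fst z) (snd z) w" by (auto simp: paths_def)
    have "v = fst z" using a yz(3) by (auto simp: path_target_def path_source_def)
    with a b have "awalk (fst y) (snd y @ snd z) w" by (auto intro: awalk_appendI)
    then show ?thesis using yz(4) by (auto simp: paths_def path_concat_def)
  qed
  show ?thesis using 1 2 by (auto simp: path_algebra_def)
qed

lemma path_algebra_mult_assoc:
  fixes Q :: "('v, 'a) pre_digraph" and f g h :: "('v, 'a) path \<Rightarrow> 'k::field"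
  assumes Q: "wf_digraph Q"
    and f: "f \<in> carrier (path_algebra Q)" and g: "g \<in> carrier (path_algebra Q)"
    and h: "h \<in> carrier (path_algebra Q)"
  shows "f \<otimes>\<^bsub>path_algebra Q\<^esub> g \<otimes>\<^bsub>path_algebra Q\<^esub> h =
         f \<otimes>\<^bsub>path_algebra Q\<^esub> (g \<otimes>\<^bsub>path_algebra Q\<^esub> h)"
proof (rule ext)
  fix x :: "('v, 'a) path"
  interpret wf_digraph Q by fact
  obtain u p where x: "x = (u, p)" by (cases x)
  note fg = path_algebra_mult_closed[OF Q f g] and gh = path_algebra_mult_closed[OF Q g h]
  let ?n = "length p" and ?T = "\<lambda>k. awlast u (take k p)"
  let ?F = "\<lambda>j m. f (u, take j p) * g (?T j, take m (drop j p)) * h (?T (j + m), drop (j + m) p)"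
  have "(f \<otimes>\<^bsub>path_algebra Q\<^esub> g \<otimes>\<^bsub>path_algebra Q\<^esub> h) (u, p) =
     (\<Sum>k\<le>?n. \<Sum>j\<le>k. ?F j (k - j))"
    unfolding path_algebra_mult_nth[OF Q fg h] path_algebra_mult_nth[OF Q f g]
    by (intro sum.cong refl)
       (auto simp: sum_distrib_right min_def drop_take intro!: sum.cong)
  also have "\<dots> = (\<Sum>(j, m) \<in> {(i, j). i + j \<le> ?n}. ?F j m)"
    by (rule sum.triangle_reindex_eq[symmetric])
  also have "{(i, j). i + j \<le> ?n} = Sigma {..?n} (\<lambda>j. {..?n - j})"
    by auto
  also have "(\<Sum>(j, m) \<in> Sigma {..?n} (\<lambda>j. {..?n - j}). ?F j m) = (\<Sum>j\<le>?n. \<Sum>m\<le>?n - j. ?F j m)"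
    by (rule sum.Sigma[symmetric]) auto
  also have "\<dots> = (f \<otimes>\<^bsub>path_algebra Q\<^esub> (g \<otimes>\<^bsub>path_algebra Q\<^esub> h)) (u, p)"
    unfolding path_algebra_mult_nth[OF Q f gh] path_algebra_mult_nth[OF Q g h]
    by (intro sum.cong refl)
       (auto simp: sum_distrib_left awlast_append take_add mult.assoc add.commute intro!: sum.cong)
  finally show "(f \<otimes>\<^bsub>path_algebra Q\<^esub> g \<otimes>\<^bsub>path_algebra Q\<^esub> h) x =
         (f \<otimes>\<^bsub>path_algebra Q\<^esub> (g \<otimes>\<^bsub>path_algebra Q\<^esub> h)) x" unfolding x .
qed

lemma scalar_elem_closed:
  assumes "fin_digraph Q"
  shows "scalar_elem Q c \<in> carrier (path_algebra Q)"
proof -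
  interpret fin_digraph Q by fact
  have "{x. scalar_elem Q c x \<noteq> 0} \<subseteq> (\<lambda>u. (u, [])) ` verts Q"
    by (auto simp: scalar_elem_def split: if_splits)
  then have "finite {x. scalar_elem Q c x \<noteq> 0}"
    by (rule finite_subset) simp
  moreover have "{x. scalar_elem Q c x \<noteq> 0} \<subseteq> paths Q"
    by (auto simp: paths_def scalar_elem_def awalk_Nil_iff split: if_splits)
  ultimately show ?thesis
    by (simp add: path_algebra_def)
qed

lemma path_algebra_scalar_mult:
  fixes Q :: "('v, 'a) pre_digraph" and f :: "('v, 'a) path \<Rightarrow> 'k::field"
  assumes Q: "fin_digraph Q" and f: "f \<in> carrier (path_algebra Q)"
  shows "scalar_elem Q c \<otimes>\<^bsub>path_algebra Q\<^esub> f = (\<lambda>x. c * f x)"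
    and "f \<otimes>\<^bsub>path_algebra Q\<^esub> scalar_elem Q c = (\<lambda>x. c * f x)"
proof -
  interpret fin_digraph Q by fact
  note s = scalar_elem_closed[OF Q, of c]
  have sub: "(u, p) \<in> paths Q" if "f (u, p) \<noteq> 0" for u p
    using f that by (auto simp: path_algebra_def)
  have sub1: "u \<in> verts Q" if "f (u, p) \<noteq> 0" for u p
    using sub[OF that] by (auto simp: paths_def awalk_def)
  have sub2: "awlast u p \<in> verts Q" if "f (u, p) \<noteq> 0" for u p
    using sub[OF that] by (auto simp: paths_def)
  show "scalar_elem Q c \<otimes>\<^bsub>path_algebra Q\<^esub> f = (\<lambda>x. c * f x)"
  proof (rule ext)
    fix x :: "('v, 'a) path"
    obtain u p where x: "x = (u, p)" by (cases x)
    have "(scalar_elem Q c \<otimes>\<^bsub>path_algebra Q\<^esub> f) (u, p) =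
      (\<Sum>k\<le>length p. if k = 0 then c * f (u, p) else 0)"
      unfolding path_algebra_mult_nth[OF wf_digraph s f]
      by (intro sum.cong refl) (use sub1 in \<open>auto simp: scalar_elem_def\<close>)
    then show "(scalar_elem Q c \<otimes>\<^bsub>path_algebra Q\<^esub> f) x = c * f x" by (simp add: x)
  qed
  show "f \<otimes>\<^bsub>path_algebra Q\<^esub> scalar_elem Q c = (\<lambda>x. c * f x)"
  proof (rule ext)
    fix x :: "('v, 'a) path"
    obtain u p where x: "x = (u, p)" by (cases x)
    have "(f \<otimes>\<^bsub>path_algebra Q\<^esub> scalar_elem Q c) (u, p) =
      (\<Sum>k\<le>length p. if k = length p then c * f (u, p) else 0)"
      unfolding path_algebra_mult_nth[OF wf_digraph f s]
      by (intro sum.cong refl) (use sub2 in \<open>auto simp: scalar_elem_def\<close>)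
    then show "(f \<otimes>\<^bsub>path_algebra Q\<^esub> scalar_elem Q c) x = c * f x" by (simp add: x)
  qed
qed

lemma ring_path_algebra:
  fixes Q :: "('v, 'a) pre_digraph"
  assumes Q: "fin_digraph Q"
  shows "ring (path_algebra Q :: (('v, 'a) path \<Rightarrow> 'k::field) ring)"
proof -
  let ?R = "path_algebra Q :: (('v, 'a) path \<Rightarrow> 'k) ring"
  interpret fin_digraph Q by fact
  have add: "x \<oplus>\<^bsub>?R\<^esub> y \<in> carrier ?R" if "x \<in> carrier ?R" "y \<in> carrier ?R" for x y
  proof -
    have "{z. x z + y z \<noteq> 0} \<subseteq> {z. x z \<noteq> 0} \<union> {z. y z \<noteq> 0}" by auto
    then show ?thesis using that
      by (auto simp: path_algebra_def dest: finite_subset)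
  qed
  show ?thesis
  proof (rule ringI)
    show "abelian_group ?R"
    proof (rule abelian_groupI)
      fix x assume x: "x \<in> carrier ?R"
      then have "(\<lambda>z. - x z) \<in> carrier ?R" by (auto simp: path_algebra_def)
      then show "\<exists>y\<in>carrier ?R. y \<oplus>\<^bsub>?R\<^esub> x = \<zero>\<^bsub>?R\<^esub>"
        by (rule bexI[rotated]) (auto simp: path_algebra_def)
    qed (use add in \<open>auto simp: path_algebra_def algebra_simps\<close>)
    show "monoid ?R"
    proof (rule monoidI)
      have one: "\<one>\<^bsub>?R\<^esub> = scalar_elem Q 1" by (simp add: path_algebra_def)
      show "\<one>\<^bsub>?R\<^esub> \<in> carrier ?R" unfolding one by (rule scalar_elem_closed[OF Q])
      fix x assume x: "x \<in> carrier ?R"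
      show "\<one>\<^bsub>?R\<^esub> \<otimes>\<^bsub>?R\<^esub> x = x" "x \<otimes>\<^bsub>?R\<^esub> \<one>\<^bsub>?R\<^esub> = x"
        unfolding one using path_algebra_scalar_mult[OF Q x, of 1] by auto
    qed (simp_all add: path_algebra_mult_closed path_algebra_mult_assoc wf_digraph)
  next
    fix x y z assume xyz: "x \<in> carrier ?R" "y \<in> carrier ?R" "z \<in> carrier ?R"
    have plus: "\<And>f g w. (f \<oplus>\<^bsub>?R\<^esub> g) w = f w + g w" by (simp add: path_algebra_def)
    note nth = path_algebra_mult_nth[OF wf_digraph]
    show "(x \<oplus>\<^bsub>?R\<^esub> y) \<otimes>\<^bsub>?R\<^esub> z = x \<otimes>\<^bsub>?R\<^esub> z \<oplus>\<^bsub>?R\<^esub> y \<otimes>\<^bsub>?R\<^esub> z"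
      by (rule ext, rename_tac w, case_tac w)
         (simp add: plus nth add xyz sum.distrib algebra_simps)
    show "z \<otimes>\<^bsub>?R\<^esub> (x \<oplus>\<^bsub>?R\<^esub> y) = z \<otimes>\<^bsub>?R\<^esub> x \<oplus>\<^bsub>?R\<^esub> z \<otimes>\<^bsub>?R\<^esub> y"
      by (rule ext, rename_tac w, case_tac w)
         (simp add: plus nth add xyz sum.distrib algebra_simps)
  qed
qed


definition path_elem :: "('v, 'a) path \<Rightarrow> ('v, 'a) path \<Rightarrow> 'k::field" where
  "path_elem x = (\<lambda>y. if y = x then 1 else 0)"

abbreviation vertex_elem :: "'v \<Rightarrow> ('v, 'a) path \<Rightarrow> 'k::field" where
  "vertex_elem i \<equiv> path_elem (i, [])"

abbreviation arrow_elem :: "('v, 'a) pre_digraph \<Rightarrow> 'a \<Rightarrow> ('v, 'a) path \<Rightarrow> 'k::field" where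
  "arrow_elem Q a \<equiv> path_elem (tail Q a, [a])"

definition arrow_ideal :: "('v, 'a) pre_digraph \<Rightarrow> (('v, 'a) path \<Rightarrow> 'k::field) set" where
  "arrow_ideal Q = Idl\<^bsub>path_algebra Q\<^esub> (arrow_elem Q ` arcs Q)"

definition admissible_ideal ::
    "('v, 'a) pre_digraph \<Rightarrow> (('v, 'a) path \<Rightarrow> 'k::field) set \<Rightarrow> bool" where
  "admissible_ideal Q I \<longleftrightarrow>
     ideal I (path_algebra Q) \<and> I \<subseteq> arrow_ideal Q \<cdot>\<^bsub>path_algebra Q\<^esub> arrow_ideal Q"

text \<open>
  \<open>arrow_product_in Q I a b\<close> says that the product of two arrows lies in \<open>I\<close>; this is
  automatically so if they do not compose, as the product is then \<open>0\<close>.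
\<close>

definition arrow_product_in ::
    "('v, 'a) pre_digraph \<Rightarrow> (('v, 'a) path \<Rightarrow> 'k::field) set \<Rightarrow> 'a \<Rightarrow> 'a \<Rightarrow> bool" where
  "arrow_product_in Q I a b \<longleftrightarrow> arrow_elem Q a \<otimes>\<^bsub>path_algebra Q\<^esub> arrow_elem Q b \<in> I"

locale locally_gentle_quiver = fin_digraph Q
  for Q :: "('v, 'a) pre_digraph" +
  fixes I :: "(('v, 'a) path \<Rightarrow> 'k::field) set"
  assumes admissible: "admissible_ideal Q I"
    and out_degree_le: "v \<in> verts Q \<Longrightarrow> out_degree Q v \<le> 2"
    and in_degree_le: "v \<in> verts Q \<Longrightarrow> in_degree Q v \<le> 2"
    and nonrel_right: "a \<in> arcs Q \<Longrightarrow> card {b \<in> arcs Q. \<not> arrow_product_in Q I a b} \<le> 1"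
    and nonrel_left: "a \<in> arcs Q \<Longrightarrow> card {c \<in> arcs Q. \<not> arrow_product_in Q I c a} \<le> 1"
    and generated: "\<exists>P. P \<subseteq> {x \<in> paths Q. path_length x = 2} \<and>
                        I = Idl\<^bsub>path_algebra Q\<^esub> (path_elem ` P)"
    and rel_right: "a \<in> arcs Q \<Longrightarrow>
      card {b \<in> arcs Q. head Q a = tail Q b \<and> arrow_product_in Q I a b} \<le> 1"
    and rel_left: "a \<in> arcs Q \<Longrightarrow>
      card {c \<in> arcs Q. head Q c = tail Q a \<and> arrow_product_in Q I c a} \<le> 1"

definition quiver_algebra ::
    "('v, 'a) pre_digraph \<Rightarrow> (('v, 'a) path \<Rightarrow> 'k::field) set \<Rightarrow> (('v, 'a) path \<Rightarrow> 'k) set ring" where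
  "quiver_algebra Q I = path_algebra Q Quot I"

text \<open>
  The residue class map, the image of the ground field in \<open>A = KQ/I\<close> (over which dimensions are
  taken), the homogeneous component \<open>A\<^sub>n\<close>, and \<open>(e\<^sub>i A e\<^sub>j)\<^sub>n\<close>.
\<close>

definition residue_class ::
    "('v, 'a) pre_digraph \<Rightarrow> (('v, 'a) path \<Rightarrow> 'k::field) set \<Rightarrow> (('v, 'a) path \<Rightarrow> 'k) \<Rightarrow>
       (('v, 'a) path \<Rightarrow> 'k) set" where
  "residue_class Q I f = I +>\<^bsub>path_algebra Q\<^esub> f"

definition ground_field ::
    "('v, 'a) pre_digraph \<Rightarrow> (('v, 'a) path \<Rightarrow> 'k::field) set \<Rightarrow> (('v, 'a) path \<Rightarrow> 'k) set set" where
  "ground_field Q I = range (\<lambda>c. residue_class Q I (scalar_elem Q c))"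

definition degree_part ::
    "('v, 'a) pre_digraph \<Rightarrow> (('v, 'a) path \<Rightarrow> 'k::field) set \<Rightarrow> nat \<Rightarrow>
       (('v, 'a) path \<Rightarrow> 'k) set set" where
  "degree_part Q I n =
     residue_class Q I ` {f \<in> carrier (path_algebra Q). \<forall>x. f x \<noteq> 0 \<longrightarrow> path_length x = n}"

definition corner_part ::
    "('v, 'a) pre_digraph \<Rightarrow> (('v, 'a) path \<Rightarrow> 'k::field) set \<Rightarrow> 'v \<Rightarrow> 'v \<Rightarrow> nat \<Rightarrow>
       (('v, 'a) path \<Rightarrow> 'k) set set" where
  "corner_part Q I i j n =
     {residue_class Q I (vertex_elem i) \<otimes>\<^bsub>quiver_algebra Q I\<^esub> a
        \<otimes>\<^bsub>quiver_algebra Q I\<^esub> residue_class Q I (vertex_elem j) | a.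
        a \<in> carrier (quiver_algebra Q I)} \<inter> degree_part Q I n"

definition q_cartan ::
    "('v, 'a) pre_digraph \<Rightarrow> (('v, 'a) path \<Rightarrow> 'k::field) set \<Rightarrow> 'v \<Rightarrow> 'v \<Rightarrow> int fps" where
  "q_cartan Q I i j =
     Abs_fps (\<lambda>n. int (ring.dim (quiver_algebra Q I) (ground_field Q I) (corner_part Q I i j n)))"

text \<open>
  The \<open>q\<close>-Cartan matrix, with rows and columns indexed along an enumeration of the vertices.
\<close>

definition q_cartan_matrix ::
    "('v, 'a) pre_digraph \<Rightarrow> (('v, 'a) path \<Rightarrow> 'k::field) set \<Rightarrow> 'v list \<Rightarrow> int fps mat" where
  "q_cartan_matrix Q I vs =
     mat (length vs) (length vs) (\<lambda>(r, s). q_cartan Q I (vs ! r) (vs ! s))"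

text \<open>
  Nontrivial closed paths with pairwise distinct arrows (i.e. closed \<^const>\<open>pre_digraph.trail\<close>s) all of whose cyclically consecutive pairs of arrows
  satisfy \<open>R\<close>, up to rotation. Unlike in \<^const>\<open>pre_digraph.cycle\<close>, vertices may repeat.
\<close>

definition minimal_cycles ::
    "('v, 'a) pre_digraph \<Rightarrow> ('a \<Rightarrow> 'a \<Rightarrow> bool) \<Rightarrow> 'a list set set" where
  "minimal_cycles Q R =
     {p. p \<noteq> [] \<and> (\<exists>u. pre_digraph.trail Q u p u) \<and>
         (\<forall>i < length p. R (p ! i) (p ! (Suc i mod length p)))}
     // {(p, p'). \<exists>k. p' = rotate k p}"

definition zero_cycles ::
    "('v, 'a) pre_digraph \<Rightarrow> (('v, 'a) path \<Rightarrow> 'k::field) set \<Rightarrow> 'a list set set" where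
  "zero_cycles Q I = minimal_cycles Q (arrow_product_in Q I)"

definition nonzero_cycles ::
    "('v, 'a) pre_digraph \<Rightarrow> (('v, 'a) path \<Rightarrow> 'k::field) set \<Rightarrow> 'a list set set" where
  "nonzero_cycles Q I = minimal_cycles Q (\<lambda>a b. \<not> arrow_product_in Q I a b)"

definition cycle_length :: "'a list set \<Rightarrow> nat" where
  "cycle_length C = (THE l. \<forall>p \<in> C. length p = l)"

lemma cycle_length_rotations:
  "cycle_length ({(p, p'). \<exists>k. p' = rotate k p} `` {p}) = length p"
proof -
  have "{(p, p'). \<exists>k. p' = rotate k p} `` {p} = range (\<lambda>k. rotate k p)"
    by blast
  then show ?thesis
    by (simp add: cycle_length_def)
qed

end

theory Submission
  imports Defs
begin

text \<open>
  The determinant is a ratio of two arrow-indexed determinants, each of which reads off one kind of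
  cycle. Write \<open>N\<close> and \<open>Z\<close> for the \<open>0\<close>-\<open>1\<close> matrices, indexed by the arrows, of the composable pairs
  of arrows whose product is nonzero, respectively zero, in \<open>A = KQ/I\<close>. Let the vertex-by-arrow
  matrix \<open>S\<close> mark the tail of each arrow and the arrow-by-vertex matrix \<open>T\<close> its head.

  As \<open>I\<close> is generated by paths of length two, it consists of the combinations of paths that contain
  a generator (\<open>I_eq_vanishing\<close>). So the remaining paths form a basis of \<open>A\<close>, compatible with its
  grading and its corners, and the entries of the \<open>q\<close>-Cartan matrix \<open>C\<close> count walks that avoid
  the pairs in \<open>Z\<close> (\<open>dim_corner_part\<close>). Splitting off the last arrow of such a walk gives
  \<open>C = 1 + U T\<close> and \<open>U (1 - q N) = q S\<close>, where \<open>U\<close> counts the nontrivial walks by initial vertex and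
  last arrow.

  Evaluating one block determinant by its two Schur complements (\<open>det_one_plus_mult\<close>) turns this
  into \<open>det C \<cdot> det (1 - q N) = det (1 - q N + q T S)\<close>. Now \<open>T S\<close> marks all composable pairs, that is
  \<open>T S = N + Z\<close>, whence \<open>det C = det (1 + q Z) / det (1 - q N)\<close> (\<open>det_walk_series\<close>).

  Local gentleness makes each of \<open>N\<close> and \<open>Z\<close> the matrix of a partial function on the arrows. For such
  a matrix \<open>P\<close>, the determinant of \<open>1 - x P\<close> is the product of \<open>1 - x\<^sup>l\<close> over the cycles of the
  partial function, \<open>l\<close> being the length of the cycle (\<open>det_relation_kernel\<close>). Taking \<open>x = q\<close> for \<open>N\<close>
  and \<open>x = - q\<close> for \<open>Z\<close> gives the two products.
\<close>

section \<open>Determinants of partial functions and their cycles\<close>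

text \<open>
  Matrices whose index set is an arbitrary finite set, enumerated by a list. By
  \<open>det_kernel_mat_mset_cong\<close> the determinant does not depend on the enumeration, so the list can be
  rearranged at will to expose a block structure.
\<close>

definition kernel_mat :: "('x \<Rightarrow> 'x \<Rightarrow> 'r) \<Rightarrow> 'x list \<Rightarrow> 'r mat" where
  "kernel_mat K xs = mat (length xs) (length xs) (\<lambda>(i, j). K (xs ! i) (xs ! j))"

lemma kernel_mat_carrier [simp]: "kernel_mat K xs \<in> carrier_mat (length xs) (length xs)"
  by (simp add: kernel_mat_def)

text \<open>
  Passing to another enumeration permutes the rows and the columns alike, and the two signs cancel.
\<close>

lemma det_kernel_mat_mset_cong:
  fixes K :: "'x \<Rightarrow> 'x \<Rightarrow> 'r::comm_ring_1"
  assumes "mset xs = mset ys"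
  shows "det (kernel_mat K xs) = det (kernel_mat K ys)"
proof -
  obtain p where p: "p permutes {..<length ys}" "permute_list p ys = xs"
    using mset_eq_permutation[OF assms] .
  let ?n = "length ys"
  have p0: "p permutes {0..<?n}" using p(1) by (simp add: atLeast0LessThan)
  have len: "length xs = ?n" using p(2) by auto
  have lt: "p i < ?n" if "i < ?n" for i using permutes_in_image[OF p(1)] that by auto
  have nth: "xs ! i = ys ! p i" if "i < ?n" for i
    using permute_list_nth[OF p(1) that] p(2) by simp
  define B where "B = mat ?n ?n (\<lambda>(i, j). K (ys ! p i) (ys ! j))"
  have "det B = signof p * det (kernel_mat K ys)"
    unfolding B_def
    by (subst det_permute_rows[OF kernel_mat_carrier p0, symmetric])
       (intro arg_cong[of _ _ det] eq_matI, auto simp: kernel_mat_def lt)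
  moreover have "det (kernel_mat K xs) = signof p * det B"
  proof -
    have "det (kernel_mat K xs) = det (transpose_mat (kernel_mat K xs))"
      by (subst det_transpose[OF kernel_mat_carrier]) simp
    also have "transpose_mat (kernel_mat K xs) = mat ?n ?n (\<lambda>(i, j). transpose_mat B $$ (p i, j))"
      by (intro eq_matI) (auto simp: kernel_mat_def B_def len nth lt)
    also have "det \<dots> = signof p * det (transpose_mat B)"
      by (rule det_permute_rows[OF _ p0]) (simp add: B_def)
    also have "det (transpose_mat B) = det B"
      by (rule det_transpose[of _ ?n]) (simp add: B_def)
    finally show ?thesis .
  qed
  moreover have "signof p * (signof p :: 'r) = 1"
    by (auto simp: sign_def)
  ultimately show ?thesis by (simp add: mult.assoc[symmetric])
qed

lemma det_kernel_mat_append: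
  fixes K :: "'x \<Rightarrow> 'x \<Rightarrow> 'r::idom"
  assumes "\<And>x y. x \<in> set xs \<Longrightarrow> y \<in> set ys \<Longrightarrow> K x y = 0"
  shows "det (kernel_mat K (xs @ ys)) = det (kernel_mat K xs) * det (kernel_mat K ys)"
proof -
  let ?n = "length xs" and ?m = "length ys"
  have "kernel_mat K (xs @ ys) = four_block_mat (kernel_mat K xs) (0\<^sub>m ?n ?m)
          (mat ?m ?n (\<lambda>(i, j). K (ys ! i) (xs ! j))) (kernel_mat K ys)"
    by (rule eq_matI) (auto simp: kernel_mat_def nth_append assms)
  then show ?thesis
    by (simp add: det_four_block_mat_upper_right_zero[of _ ?n _ ?m])
qed

definition relation_kernel :: "'r \<Rightarrow> ('x \<Rightarrow> 'x \<Rightarrow> bool) \<Rightarrow> 'x \<Rightarrow> 'x \<Rightarrow> 'r::comm_ring_1" where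
  "relation_kernel x R a b = of_bool (a = b) - x * of_bool (R a b)"

text \<open>
  In length at least two the matrix has \<open>1\<close> on the diagonal, \<open>- x\<close> just above it, and \<open>- x\<close> in the
  lower left corner. Expanding along the first column leaves two minors, one upper triangular with diagonal \<open>1\<close>,
  the other lower triangular with diagonal \<open>- x\<close>.
\<close>

lemma det_single_cycle:
  fixes x :: "'r::comm_ring_1"
  assumes "distinct p" "p \<noteq> []"
    and R: "\<And>i j. i < length p \<Longrightarrow> j < length p \<Longrightarrow>
              R (p ! i) (p ! j) \<longleftrightarrow> j = Suc i mod length p"
  shows "det (kernel_mat (relation_kernel x R) p) = 1 - x ^ length p"
proof (cases "length p = 1")
  case True
  then show ?thesis
    using R[of 0 0] by (simp add: det_single kernel_mat_def relation_kernel_def)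
next
  case False
  define n where "n = length p - 2"
  have n: "length p = Suc (Suc n)" using False assms(2) by (cases p; cases "tl p") (auto simp: n_def)
  let ?A = "kernel_mat (relation_kernel x R) p"
  \<comment> \<open>The last index is \<open>n + 1\<close>. In length at least two the corner entry lies off the diagonal.\<close>
  have entry: "?A $$ (i, j) = of_bool (i = j) - x * of_bool (j = (if i = Suc n then 0 else Suc i))"
    if "i < Suc (Suc n)" "j < Suc (Suc n)" for i j
  proof -
    have "Suc i mod Suc (Suc n) = (if i = Suc n then 0 else Suc i)" using that by auto
    then show ?thesis
      using that assms(1) R[of i j]
      by (simp add: kernel_mat_def relation_kernel_def n nth_eq_iff_index_eq)
  qed
  have A: "?A \<in> carrier_mat (Suc (Suc n)) (Suc (Suc n))"
    using kernel_mat_carrier[of _ p] n by simp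
  have del: "mat_delete ?A i j \<in> carrier_mat (Suc n) (Suc n)" for i j
    using mat_delete_carrier[OF A] by simp
  have del_entry: "mat_delete ?A i j $$ (k, l) = ?A $$ (if k < i then k else Suc k, if l < j then l else Suc l)"
    if "k < Suc n" "l < Suc n" for i j k l
    using A that by (simp add: mat_delete_def)
  have "det ?A = (\<Sum>i<Suc (Suc n). ?A $$ (i, 0) * cofactor ?A i 0)"
    by (rule laplace_expansion_column[OF A]) simp
  also have "\<dots> = (\<Sum>i\<in>{0, Suc n}. ?A $$ (i, 0) * cofactor ?A i 0)"
    by (rule sum.mono_neutral_right) (auto simp: entry)
  also have "\<dots> = cofactor ?A 0 0 - x * cofactor ?A (Suc n) 0"
    by (simp add: entry)
  also have "cofactor ?A 0 0 = 1"
  proof -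
    have "det (mat_delete ?A 0 0) = prod_list (diag_mat (mat_delete ?A 0 0))"
    proof (rule det_upper_triangular[OF _ del])
      show "upper_triangular (mat_delete ?A 0 0)"
        unfolding upper_triangular_def
        using del[of 0 0] by (auto simp: del_entry entry)
    qed
    also have "\<dots> = 1"
      by (simp add: prod_list_diag_prod carrier_matD(1)[OF A] del_entry entry)
    finally show ?thesis by (simp add: cofactor_def)
  qed
  also have "cofactor ?A (Suc n) 0 = (-1) ^ Suc n * (-x) ^ Suc n"
  proof -
    have "det (mat_delete ?A (Suc n) 0) = prod_list (diag_mat (mat_delete ?A (Suc n) 0))"
      by (rule det_lower_triangular[OF _ del]) (auto simp: del_entry entry)
    also have "\<dots> = (-x) ^ Suc n"
      by (simp add: prod_list_diag_prod carrier_matD(1)[OF A] del_entry entry)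
    finally show ?thesis by (simp add: cofactor_def)
  qed
  also have "(-1) ^ Suc n * (-x) ^ Suc n = x ^ Suc n"
    by (simp add: power_mult_distrib[symmetric] del: power_Suc)
  finally show ?thesis by (simp add: n)
qed


text \<open>
  Simple cycles modulo rotation, with the same relation as in \<^const>\<open>minimal_cycles\<close>, but for
  an arbitrary relation on a set in place of the arrows of a quiver: this is what an induction over
  subsets of the arrows needs.
\<close>

definition rotation_rel :: "('x list \<times> 'x list) set" where
  "rotation_rel = {(p, p'). \<exists>k. p' = rotate k p}"

lemma equiv_rotation_rel: "equiv UNIV rotation_rel"
proof (rule equivI)
  show "refl rotation_rel"
    by (auto simp: refl_on_def rotation_rel_def intro: exI[of _ 0])
  show "sym rotation_rel"
  proof (rule symI)
    fix p q :: "'x list" assume "(p, q) \<in> rotation_rel"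
    then obtain k where q: "q = rotate k p" by (auto simp: rotation_rel_def)
    have "rotate (length p * k - k) q = rotate (length p * k) p" if "p \<noteq> []"
    proof -
      have "length p * k - k + k = length p * k" using that by (cases p) auto
      then show ?thesis by (simp add: q rotate_rotate)
    qed
    also have "rotate (length p * k) p = p" by (simp add: rotate_id)
    finally have "p = rotate (length p * k - k) q"
      by (cases "p = []") (auto simp: q)
    then show "(q, p) \<in> rotation_rel" unfolding rotation_rel_def by blast
  qed
  show "trans rotation_rel"
    by (auto simp: trans_def rotation_rel_def rotate_rotate)
qed auto

definition simple_cycles :: "('x \<Rightarrow> 'x \<Rightarrow> bool) \<Rightarrow> 'x set \<Rightarrow> 'x list set" where
  "simple_cycles R A = {p. p \<noteq> [] \<and> distinct p \<and> set p \<subseteq> A \<and>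
     (\<forall>i < length p. R (p ! i) (p ! (Suc i mod length p)))}"

lemma finite_simple_cycles: "finite A \<Longrightarrow> finite (simple_cycles R A)"
  by (rule finite_subset[OF _ finite_subset_distinct[of A]]) (auto simp: simple_cycles_def)

lemma rotate_simple_cycles:
  assumes "p \<in> simple_cycles R A"
  shows "rotate k p \<in> simple_cycles R A"
proof -
  have "R (rotate k p ! i) (rotate k p ! (Suc i mod length p))" if "i < length p" for i
  proof -
    have "p \<noteq> []" using assms by (auto simp: simple_cycles_def)
    then have "rotate k p ! (Suc i mod length p) = p ! (Suc ((k + i) mod length p) mod length p)"
      by (subst nth_rotate) (auto simp: mod_simps)
    moreover have "rotate k p ! i = p ! ((k + i) mod length p)"
      using that by (simp add: nth_rotate)
    ultimately show ?thesis using assms \<open>p \<noteq> []\<close> by (auto simp: simple_cycles_def)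
  qed
  then show ?thesis using assms by (auto simp: simple_cycles_def)
qed

text \<open>
  Rotate both cycles so that they start at the common element. From there each of them is forced to
  follow the relation, so their periodic continuations agree; since the entries of each cycle are
  distinct, the common continuation determines the length as its least period.
\<close>

lemma simple_cycles_meet_imp_rotation:
  assumes p: "p \<in> simple_cycles R A" and q: "q \<in> simple_cycles R A"
    and fun_R: "\<And>a b c. \<lbrakk>a \<in> A; b \<in> A; c \<in> A; R a b; R a c\<rbrakk> \<Longrightarrow> b = c"
    and meet: "a \<in> set p" "a \<in> set q"
  shows "(p, q) \<in> rotation_rel"
proof -
  obtain i j where i: "i < length p" "p ! i = a" and j: "j < length q" "q ! j = a"
    using meet by (auto simp: in_set_conv_nth)
  define p' where "p' = rotate i p"
  define q' where "q' = rotate j q"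
  note p' = rotate_simple_cycles[OF p, of i, folded p'_def]
  note q' = rotate_simple_cycles[OF q, of j, folded q'_def]
  have ne: "length p' > 0" "length q' > 0"
    using p' q' by (auto simp: simple_cycles_def)
  have 0: "p' ! 0 = q' ! 0"
    using i j ne by (simp add: p'_def q'_def nth_rotate)
  have eq: "p' ! (m mod length p') = q' ! (m mod length q')" for m
  proof (induction m)
    case (Suc m)
    have step: "R (r ! (m mod length r)) (r ! (Suc m mod length r))"
      "r ! (m mod length r) \<in> A" "r ! (Suc m mod length r) \<in> A"
      if "r \<in> simple_cycles R A" "length r > 0" for r
    proof -
      have lt: "m mod length r < length r" "Suc m mod length r < length r"
        using that(2) by auto
      have "\<forall>i < length r. R (r ! i) (r ! (Suc i mod length r))" "set r \<subseteq> A"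
        using that(1) by (auto simp: simple_cycles_def)
      then have "R (r ! (m mod length r)) (r ! (Suc (m mod length r) mod length r))"
        "r ! (m mod length r) \<in> A" "r ! (Suc m mod length r) \<in> A"
        using lt nth_mem by blast+
      then show "R (r ! (m mod length r)) (r ! (Suc m mod length r))"
        "r ! (m mod length r) \<in> A" "r ! (Suc m mod length r) \<in> A"
        by (simp_all add: mod_simps)
    qed
    from fun_R[OF step(2)[OF p' ne(1)] step(3)[OF p' ne(1)] step(3)[OF q' ne(2)] step(1)[OF p' ne(1)]]
      step(1)[OF q' ne(2)] Suc.IH
    show ?case by simp
  qed (simp add: 0)
  have dist: "distinct p'" "distinct q'"
    using p' q' by (auto simp: simple_cycles_def)
  have "length p' dvd length q'"
    using eq[of "length q'"] 0 ne nth_eq_iff_index_eq[OF dist(1), of "length q' mod length p'" 0]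
    by (auto simp: dvd_eq_mod_eq_0)
  moreover have "length q' dvd length p'"
    using eq[of "length p'"] 0 ne nth_eq_iff_index_eq[OF dist(2), of "length p' mod length q'" 0]
    by (auto simp: dvd_eq_mod_eq_0)
  ultimately have len: "length p' = length q'" by (rule dvd_antisym)
  have "p' = q'"
  proof (rule nth_equalityI[OF len])
    fix i assume "i < length p'"
    then show "p' ! i = q' ! i" using eq[of i] len by simp
  qed
  have "(p, p') \<in> rotation_rel" "(q, q') \<in> rotation_rel"
    by (auto simp: rotation_rel_def p'_def q'_def)
  with \<open>p' = q'\<close> show ?thesis
    using equiv_rotation_rel unfolding equiv_def by (meson symE transE)
qed

text \<open>
  Iterating a choice of successors on a finite set must revisit an element; the orbit up to the first
  return of a periodic element is a simple cycle.
\<close>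

lemma ex_simple_cycle:
  assumes "finite A" "A \<noteq> {}" "\<And>a. a \<in> A \<Longrightarrow> \<exists>b\<in>A. R a b"
  shows "\<exists>p. p \<in> simple_cycles R A"
proof -
  obtain f where f: "\<And>a. a \<in> A \<Longrightarrow> f a \<in> A" "\<And>a. a \<in> A \<Longrightarrow> R a (f a)"
    using assms(3) by metis
  obtain a where a: "a \<in> A" using assms(2) by auto
  have iter: "(f ^^ n) b \<in> A" if "b \<in> A" for n b
    by (induction n) (use that f in auto)
  have "\<not> inj (\<lambda>n. (f ^^ n) a)"
  proof
    assume "inj (\<lambda>n. (f ^^ n) a)"
    then have "infinite (range (\<lambda>n. (f ^^ n) a))" by (rule range_inj_infinite)
    moreover have "range (\<lambda>n. (f ^^ n) a) \<subseteq> A" using iter[OF a] by auto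
    ultimately show False using assms(1) finite_subset by blast
  qed
  then obtain m n where mn: "m < n" "(f ^^ m) a = (f ^^ n) a"
    unfolding inj_def by (metis linorder_neqE_nat)
  define b where "b = (f ^^ m) a"
  have b: "b \<in> A" using iter[OF a] by (simp add: b_def)
  have ex: "\<exists>l. 0 < l \<and> (f ^^ l) b = b"
  proof (intro exI[of _ "n - m"] conjI)
    have "(f ^^ (n - m)) b = (f ^^ (n - m + m)) a" unfolding b_def funpow_add by simp
    then show "(f ^^ (n - m)) b = b" using mn by (simp add: b_def)
  qed (use mn in auto)
  define l where "l = (LEAST l. 0 < l \<and> (f ^^ l) b = b)"
  have l: "0 < l" "(f ^^ l) b = b" using LeastI_ex[OF ex] by (auto simp: l_def)
  have min: "(f ^^ k) b \<noteq> b" if "0 < k" "k < l" for k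
    using not_less_Least[of k "\<lambda>l. 0 < l \<and> (f ^^ l) b = b"] that by (auto simp: l_def)
  define p where "p = map (\<lambda>i. (f ^^ i) b) [0..<l]"
  have "(f ^^ i) b \<noteq> (f ^^ j) b" if "i < j" "j < l" for i j
  proof
    assume *: "(f ^^ i) b = (f ^^ j) b"
    have "(f ^^ (l - j + i)) b = (f ^^ (l - j + j)) b"
      unfolding funpow_add using * by simp
    also have "\<dots> = b" using that l by simp
    finally have eq: "(f ^^ (l - j + i)) b = b" .
    have lt: "0 < l - j + i" "l - j + i < l" using that by auto
    from min[OF lt] eq show False by (rule notE)
  qed
  then have "inj_on (\<lambda>i. (f ^^ i) b) {0..<l}"
    by (intro linorder_inj_onI) auto
  then have "distinct p" by (simp add: p_def distinct_map)
  moreover have "R (p ! i) (p ! (Suc i mod length p))" if "i < length p" for i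
  proof -
    have "p ! (Suc i mod length p) = f ((f ^^ i) b)"
    proof (cases "Suc i = l")
      case True
      then show ?thesis using l by (auto simp: p_def)
    next
      case False
      then show ?thesis using that by (auto simp: p_def)
    qed
    then show ?thesis using that f(2)[OF iter[OF b]] by (simp add: p_def)
  qed
  ultimately have "p \<in> simple_cycles R A"
    using l iter[OF b] by (auto simp: simple_cycles_def p_def)
  then show ?thesis ..
qed

lemma cycle_length_rotation_class: "cycle_length (rotation_rel `` {p}) = length p"
  unfolding rotation_rel_def by (rule cycle_length_rotations)

text \<open>
  By induction on the set. An element without a successor contributes a row of the identity matrix,
  and no cycle passes through it, so it can be dropped. If every element has a successor, then there
  is a cycle. The relation does not lead out of it, which makes the matrix block triangular, and every other
  cycle is disjoint from it, so that splitting it off removes exactly one factor on either side.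
\<close>

lemma det_relation_kernel:
  fixes x :: "'r::idom"
  assumes "distinct as" "set as = A"
    and "\<And>a b c. \<lbrakk>a \<in> A; b \<in> A; c \<in> A; R a b; R a c\<rbrakk> \<Longrightarrow> b = c"
  shows "det (kernel_mat (relation_kernel x R) as) =
           (\<Prod>C \<in> simple_cycles R A // rotation_rel. 1 - x ^ cycle_length C)"
proof -
  have "finite A" using assms(2) by auto
  then show ?thesis using assms
  proof (induction A arbitrary: as rule: finite_psubset_induct)
    case (psubset A as)
    note fun_R = psubset.prems(3)
    let ?K = "relation_kernel x R"
    let ?prod = "\<lambda>S. \<Prod>C \<in> S // rotation_rel. 1 - x ^ cycle_length C"
    have perm: "det (kernel_mat ?K as) = det (kernel_mat ?K (ps @ rs))"
      if "distinct (ps @ rs)" "set (ps @ rs) = A" for ps rs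
    proof (rule det_kernel_mat_mset_cong)
      show "mset as = mset (ps @ rs)"
        using that psubset.prems(1,2) by (metis set_eq_iff_mset_eq_distinct)
    qed
    have ih: "det (kernel_mat ?K bs) = ?prod (simple_cycles R (A - B))"
      if "B \<subseteq> A" "B \<noteq> {}" "distinct bs" "set bs = A - B" for B bs
      by (rule psubset.IH) (use that fun_R in blast)+
    obtain rest where rest: "distinct (rest B)" "set (rest B) = A - B" for B
      using finite_distinct_list[OF finite_Diff[OF psubset.hyps]] by metis
    consider "A = {}" | a where "a \<in> A" "\<And>b. b \<in> A \<Longrightarrow> \<not> R a b"
      | "A \<noteq> {}" "\<And>a. a \<in> A \<Longrightarrow> \<exists>b\<in>A. R a b" by blast
    then show ?case
    proof cases
      case 1
      then have "simple_cycles R A = {}" by (auto simp: simple_cycles_def)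
      then show ?thesis using psubset.prems(2) 1
        by (simp add: kernel_mat_def quotient_def)
    next
      case 2
      let ?bs = "rest {a}"
      have "det (kernel_mat ?K as) = det (kernel_mat ?K ([a] @ ?bs))"
        by (rule perm) (use rest[of "{a}"] 2 in auto)
      also have "\<dots> = det (kernel_mat ?K [a]) * det (kernel_mat ?K ?bs)"
        by (rule det_kernel_mat_append) (use rest[of "{a}"] 2 in \<open>auto simp: relation_kernel_def\<close>)
      also have "det (kernel_mat ?K [a]) = 1"
        using 2 by (simp add: det_single kernel_mat_def relation_kernel_def)
      also have "det (kernel_mat ?K ?bs) = ?prod (simple_cycles R (A - {a}))"
        by (rule ih) (use rest[of "{a}"] 2 in auto)
      also have "simple_cycles R (A - {a}) = simple_cycles R A"
      proof -
        have "a \<notin> set p" if p: "p \<in> simple_cycles R A" for p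
        proof
          assume "a \<in> set p"
          then obtain i where i: "i < length p" "p ! i = a" by (auto simp: in_set_conv_nth)
          then have "p ! (Suc i mod length p) \<in> set p" by (intro nth_mem mod_less_divisor) linarith
          then have "p ! (Suc i mod length p) \<in> A" "R a (p ! (Suc i mod length p))"
            using i p by (auto simp: simple_cycles_def)
          then show False using 2 by blast
        qed
        then show ?thesis by (auto simp: simple_cycles_def)
      qed
      finally show ?thesis by simp
    next
      case 3
      obtain p where p: "p \<in> simple_cycles R A"
        using ex_simple_cycle[OF psubset.hyps 3(1), of R] 3(2) by blast
      let ?bs = "rest (set p)"
      have dist: "distinct p" "p \<noteq> []" "set p \<subseteq> A" using p by (auto simp: simple_cycles_def)
      have succ: "R (p ! i) b \<longleftrightarrow> b = p ! (Suc i mod length p)" if "i < length p" "b \<in> A" for i b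
      proof -
        have "p ! i \<in> A" "p ! (Suc i mod length p) \<in> A"
          using that dist by (auto intro!: subsetD[OF dist(3)] nth_mem)
        moreover have "R (p ! i) (p ! (Suc i mod length p))"
          using p that by (auto simp: simple_cycles_def)
        ultimately show ?thesis using fun_R that(2) by blast
      qed
      have "det (kernel_mat ?K as) = det (kernel_mat ?K (p @ ?bs))"
        by (rule perm) (use rest[of "set p"] dist in auto)
      also have "\<dots> = det (kernel_mat ?K p) * det (kernel_mat ?K ?bs)"
      proof (rule det_kernel_mat_append)
        fix a b assume a: "a \<in> set p" and b: "b \<in> set ?bs"
        then obtain i where i: "i < length p" "p ! i = a" by (auto simp: in_set_conv_nth)
        have "p ! (Suc i mod length p) \<in> set p" using i by (intro nth_mem mod_less_divisor) linarith
        then show "?K a b = 0"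
          using a b i rest[of "set p"] succ[of i b] by (auto simp: relation_kernel_def)
      qed
      also have "det (kernel_mat ?K p) = 1 - x ^ length p"
      proof (rule det_single_cycle[OF dist(1,2)])
        fix i j assume "i < length p" "j < length p"
        moreover from this have "p ! j \<in> A" using dist(3) nth_mem by blast
        ultimately show "R (p ! i) (p ! j) \<longleftrightarrow> j = Suc i mod length p"
          using succ[of i "p ! j"] dist(1,2) by (auto simp: nth_eq_iff_index_eq)
      qed
      also have "det (kernel_mat ?K ?bs) = ?prod (simple_cycles R (A - set p))"
        by (rule ih) (use rest[of "set p"] dist in auto)
      also have "(1 - x ^ length p) * \<dots> = ?prod (simple_cycles R A)"
      proof -
        let ?S = "simple_cycles R (A - set p)" and ?c = "rotation_rel `` {p}"
        have "simple_cycles R A = ?S \<union> ?c"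
        proof (intro equalityI subsetI)
          fix q assume q: "q \<in> simple_cycles R A"
          show "q \<in> ?S \<union> ?c"
          proof (cases "set q \<inter> set p = {}")
            case True
            then show ?thesis using q by (auto simp: simple_cycles_def)
          next
            case False
            then obtain a where a: "a \<in> set p" "a \<in> set q" by blast
            have "(p, q) \<in> rotation_rel"
              by (rule simple_cycles_meet_imp_rotation[OF p q _ a]) (rule fun_R)
            then show ?thesis by simp
          qed
        next
          fix q assume "q \<in> ?S \<union> ?c"
          moreover have "q \<in> simple_cycles R A" if "q \<in> ?S"
            using that by (auto simp: simple_cycles_def)
          moreover have "q \<in> simple_cycles R A" if "q \<in> ?c"
            using that rotate_simple_cycles[OF p] by (auto simp: rotation_rel_def)
          ultimately show "q \<in> simple_cycles R A" by blast
        qed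
        then have "simple_cycles R A // rotation_rel = insert ?c (?S // rotation_rel)"
        proof -
          have "rotation_rel `` {q} = ?c" if "q \<in> ?c" for q
            using equiv_class_eq[OF equiv_rotation_rel, of p q] that by simp
          then have "(\<Union>q\<in>?c. {rotation_rel `` {q}}) = (\<Union>q\<in>?c. {?c})"
            by (intro SUP_cong refl) simp
          also have "\<dots> = {?c}"
            using equiv_class_self[OF equiv_rotation_rel, of p] by (intro UN_constant_eq) auto
          finally have "?c // rotation_rel = {?c}" by (simp add: quotient_def)
          then show ?thesis
            using \<open>simple_cycles R A = ?S \<union> ?c\<close> by (simp add: quotient_def Un_commute)
        qed
        moreover have "?c \<notin> ?S // rotation_rel"
        proof
          assume "?c \<in> ?S // rotation_rel"
          then obtain q where q: "q \<in> ?S" "?c = rotation_rel `` {q}" by (auto simp: quotient_def)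
          have "(q, p) \<in> rotation_rel"
            using q(2) equiv_class_self[OF equiv_rotation_rel, of p] by auto
          then have "set p = set q" by (auto simp: rotation_rel_def)
          with q(1) show False by (cases q) (auto simp: simple_cycles_def)
        qed
        moreover have "finite (?S // rotation_rel)"
          using finite_simple_cycles[of "A - set p" R] psubset.hyps
          by (simp add: quotient_def)
        ultimately show ?thesis by (simp add: cycle_length_rotation_class)
      qed
      finally show ?thesis .
    qed
  qed
qed

section \<open>The determinant of the walk generating function\<close>

text \<open>
  Both sides are the determinant of the block matrix with rows \<open>(1, - V)\<close> and \<open>(T, D)\<close>: clearing the
  upper right block by means of \<open>U D = V\<close> leaves \<open>1 + U T\<close> and \<open>D\<close> on the diagonal, clearing the lower
  left block leaves \<open>1\<close> and \<open>D + T V\<close>. The inverse of \<open>D\<close> enters only through \<open>U\<close>, which stands for \<open>V D^(-1)\<close>.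
\<close>

lemma det_one_plus_mult:
  fixes U :: "'r::idom mat"
  assumes U: "U \<in> carrier_mat n m" and V: "V \<in> carrier_mat n m"
    and T: "T \<in> carrier_mat m n" and D: "D \<in> carrier_mat m m"
    and UD: "U * D = V"
  shows "det (1\<^sub>m n + U * T) * det D = det (D + T * V)"
proof -
  let ?M = "four_block_mat (1\<^sub>m n) (- V) T D"
  have M: "?M \<in> carrier_mat (n + m) (n + m)"
    using T D V by auto
  have "det (four_block_mat (1\<^sub>m n) U (0\<^sub>m m n) (1\<^sub>m m) * ?M) = det ?M"
    using U M by (subst det_mult[of _ "n + m"])
      (auto simp: det_four_block_mat_lower_left_zero[of _ n _ m])
  also have "four_block_mat (1\<^sub>m n) U (0\<^sub>m m n) (1\<^sub>m m) * ?M =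
      four_block_mat (1\<^sub>m n + U * T) (0\<^sub>m n m) T D"
    using U T D V
    by (subst mult_four_block_mat[of _ n n _ m _ m]) (auto simp: UD uminus_l_inv_mat)
  also have "det \<dots> = det (1\<^sub>m n + U * T) * det D"
    using U T D by (intro det_four_block_mat_upper_right_zero) auto
  finally have 1: "det ?M = det (1\<^sub>m n + U * T) * det D" by simp
  have "det (four_block_mat (1\<^sub>m n) (0\<^sub>m n m) (- T) (1\<^sub>m m) * ?M) = det ?M"
    using T M by (subst det_mult[of _ "n + m"])
      (auto simp: det_four_block_mat_upper_right_zero[of _ n _ m])
  also have "four_block_mat (1\<^sub>m n) (0\<^sub>m n m) (- T) (1\<^sub>m m) * ?M =
      four_block_mat (1\<^sub>m n) (- V) (0\<^sub>m m n) (D + T * V)"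
  proof -
    have "- T * - V = T * V" using T V by (intro eq_matI) auto
    moreover have "- T + T = 0\<^sub>m m n" using T by (intro eq_matI) auto
    ultimately show ?thesis
      using T D V
      by (subst mult_four_block_mat[of _ n n _ m _ m]) (auto simp: comm_add_mat[of _ m m])
  qed
  also have "det \<dots> = det (D + T * V)"
    using T D V by (subst det_four_block_mat_lower_left_zero[of _ n _ m]) auto
  finally show ?thesis using 1 by simp
qed

definition avoiding_walks ::
    "('v, 'a) pre_digraph \<Rightarrow> ('a \<Rightarrow> 'a \<Rightarrow> bool) \<Rightarrow> 'v \<Rightarrow> 'v \<Rightarrow> nat \<Rightarrow> 'a list set" where
  "avoiding_walks Q Z i j n =
     {p. pre_digraph.awalk Q i p j \<and> length p = n \<and> successively (\<lambda>a b. \<not> Z a b) p}"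

definition avoiding_walks_via ::
    "('v, 'a) pre_digraph \<Rightarrow> ('a \<Rightarrow> 'a \<Rightarrow> bool) \<Rightarrow> 'v \<Rightarrow> 'a \<Rightarrow> nat \<Rightarrow> 'a list set" where
  "avoiding_walks_via Q Z i b n = {p \<in> avoiding_walks Q Z i (head Q b) n. p \<noteq> [] \<and> last p = b}"

context fin_digraph
begin

lemma finite_avoiding_walks: "finite (avoiding_walks G Z i j n)"
  by (rule finite_subset[OF _ finite_lists_length_eq[OF finite_arcs, of n]])
     (auto simp: avoiding_walks_def awalk_def)

lemma finite_avoiding_walks_via: "finite (avoiding_walks_via G Z i b n)"
  by (rule finite_subset[OF _ finite_avoiding_walks[of Z i "head G b" n]]) (auto simp: avoiding_walks_via_def)

lemma avoiding_walks_Suc: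
  "avoiding_walks G Z i j (Suc n) = (\<Union>b\<in>{b \<in> arcs G. head G b = j}. avoiding_walks_via G Z i b (Suc n))"
proof (intro equalityI subsetI)
  fix p assume p: "p \<in> avoiding_walks G Z i j (Suc n)"
  then have ne: "p \<noteq> []" by (auto simp: avoiding_walks_def)
  have w: "awalk i p j" using p by (auto simp: avoiding_walks_def)
  then have "last p \<in> arcs G" "head G (last p) = j"
    using ne by (auto simp: awalk_conv awalk_verts_conv split: if_splits)
  then show "p \<in> (\<Union>b\<in>{b \<in> arcs G. head G b = j}. avoiding_walks_via G Z i b (Suc n))"
    using p ne by (auto simp: avoiding_walks_via_def)
qed (auto simp: avoiding_walks_via_def)

lemma awalk_snoc_iff:
  "awalk i (p @ [b]) v \<longleftrightarrow> awalk i p (tail G b) \<and> b \<in> arcs G \<and> v = head G b"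
  by (auto simp: awalk_append_iff awalk_simps)

lemma avoiding_walks_via_1:
  assumes "b \<in> arcs G"
  shows "avoiding_walks_via G Z i b (Suc 0) = (if tail G b = i then {[b]} else {})"
  using assms by (auto simp: avoiding_walks_via_def avoiding_walks_def length_Suc_conv awalk_simps)

text \<open>
  Removing the last arrow of a walk of length at least two; this is the recursion behind
  \<open>walk_series_via_eq\<close>. In length one there is no preceding arrow, which accounts for the extra term
  there.
\<close>

lemma avoiding_walks_via_Suc_Suc:
  assumes "b \<in> arcs G"
  shows "avoiding_walks_via G Z i b (Suc (Suc n)) =
    (\<Union>a\<in>{a \<in> arcs G. head G a = tail G b \<and> \<not> Z a b}.
       (\<lambda>p. p @ [b]) ` avoiding_walks_via G Z i a (Suc n))"
proof (intro equalityI subsetI)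
  fix p assume p: "p \<in> avoiding_walks_via G Z i b (Suc (Suc n))"
  define q where "q = butlast p"
  have pq: "p = q @ [b]"
    using p by (auto simp: q_def avoiding_walks_via_def append_butlast_last_id)
  have ne: "q \<noteq> []" using p by (auto simp: pq avoiding_walks_via_def avoiding_walks_def)
  have w: "awalk i q (tail G b)" and s: "successively (\<lambda>a b. \<not> Z a b) q" "\<not> Z (last q) b"
    and l: "length q = Suc n"
    using p ne by (auto simp: pq avoiding_walks_via_def avoiding_walks_def awalk_snoc_iff
        successively_append_iff)
  have "last q \<in> arcs G" "head G (last q) = tail G b"
    using w ne by (auto simp: awalk_conv awalk_verts_conv split: if_splits)
  then show "p \<in> (\<Union>a\<in>{a \<in> arcs G. head G a = tail G b \<and> \<not> Z a b}.
       (\<lambda>p. p @ [b]) ` avoiding_walks_via G Z i a (Suc n))"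
    using w s l ne by (auto simp: pq avoiding_walks_via_def avoiding_walks_def)
next
  fix p assume "p \<in> (\<Union>a\<in>{a \<in> arcs G. head G a = tail G b \<and> \<not> Z a b}.
       (\<lambda>p. p @ [b]) ` avoiding_walks_via G Z i a (Suc n))"
  then show "p \<in> avoiding_walks_via G Z i b (Suc (Suc n))"
    using assms by (auto simp: avoiding_walks_via_def avoiding_walks_def awalk_snoc_iff
        successively_append_iff arc_implies_awalk)
qed

lemma card_avoiding_walks_Suc:
  "card (avoiding_walks G Z i j (Suc n)) =
     (\<Sum>b\<in>arcs G. card (avoiding_walks_via G Z i b (Suc n)) * of_bool (head G b = j))"
proof -
  have "card (avoiding_walks G Z i j (Suc n)) =
      (\<Sum>b\<in>{b \<in> arcs G. head G b = j}. card (avoiding_walks_via G Z i b (Suc n)))"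
    unfolding avoiding_walks_Suc
    by (rule card_UN_disjoint) (simp_all add: finite_avoiding_walks_via, auto simp: avoiding_walks_via_def)
  also have "\<dots> = (\<Sum>b\<in>arcs G. card (avoiding_walks_via G Z i b (Suc n)) * of_bool (head G b = j))"
    by (subst sum.inter_filter[OF finite_arcs], rule sum.cong) auto
  finally show ?thesis .
qed

lemma card_avoiding_walks_via_Suc_Suc:
  assumes "b \<in> arcs G"
  shows "card (avoiding_walks_via G Z i b (Suc (Suc n))) =
    (\<Sum>a\<in>arcs G. card (avoiding_walks_via G Z i a (Suc n)) *
       of_bool (head G a = tail G b \<and> \<not> Z a b))"
proof -
  have "card (avoiding_walks_via G Z i b (Suc (Suc n))) =
      (\<Sum>a\<in>{a \<in> arcs G. head G a = tail G b \<and> \<not> Z a b}.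
         card ((\<lambda>p. p @ [b]) ` avoiding_walks_via G Z i a (Suc n)))"
    unfolding avoiding_walks_via_Suc_Suc[OF assms]
    by (rule card_UN_disjoint) (simp_all add: finite_avoiding_walks_via, auto simp: avoiding_walks_via_def)
  also have "\<dots> = (\<Sum>a\<in>{a \<in> arcs G. head G a = tail G b \<and> \<not> Z a b}.
         card (avoiding_walks_via G Z i a (Suc n)))"
    by (intro sum.cong refl card_image) (auto simp: inj_on_def)
  also have "\<dots> = (\<Sum>a\<in>arcs G. card (avoiding_walks_via G Z i a (Suc n)) *
       of_bool (head G a = tail G b \<and> \<not> Z a b))"
    by (subst sum.inter_filter[OF finite_arcs], rule sum.cong) auto
  finally show ?thesis .
qed

definition walk_series :: "('b \<Rightarrow> 'b \<Rightarrow> bool) \<Rightarrow> 'a \<Rightarrow> 'a \<Rightarrow> int fps" where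
  "walk_series Z i j = Abs_fps (\<lambda>n. int (card (avoiding_walks G Z i j n)))"

definition walk_series_via :: "('b \<Rightarrow> 'b \<Rightarrow> bool) \<Rightarrow> 'a \<Rightarrow> 'b \<Rightarrow> int fps" where
  "walk_series_via Z i b = Abs_fps (\<lambda>n. int (card (avoiding_walks_via G Z i b n)))"

lemma avoiding_walks_via_0: "avoiding_walks_via G Z i b 0 = {}"
  by (auto simp: avoiding_walks_via_def avoiding_walks_def)

lemma fps_mult_of_bool_nth: "fps_nth (f * of_bool B) n = fps_nth f n * of_bool B"
  for f :: "'r::comm_ring_1 fps"
  by simp

text \<open>
  The equations \<open>C = 1 + U T\<close> and, below, \<open>U = q S + U q N\<close>, entry by entry.
\<close>

lemma walk_series_eq:
  assumes "i \<in> verts G"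
  shows "walk_series Z i j =
    of_bool (i = j) + (\<Sum>b\<in>arcs G. walk_series_via Z i b * of_bool (head G b = j))"
proof (rule fps_ext)
  fix n
  show "fps_nth (walk_series Z i j) n =
    fps_nth (of_bool (i = j) + (\<Sum>b\<in>arcs G. walk_series_via Z i b * of_bool (head G b = j))) n"
  proof (cases n)
    case 0
    have "avoiding_walks G Z i j 0 = (if i = j then {[]} else {})"
      using assms by (auto simp: avoiding_walks_def awalk_simps)
    then show ?thesis
      using 0 by (simp add: walk_series_def walk_series_via_def fps_sum_nth avoiding_walks_via_0)
  next
    case (Suc m)
    then show ?thesis
      by (simp add: walk_series_def walk_series_via_def fps_sum_nth card_avoiding_walks_Suc
          fps_mult_of_bool_nth)
  qed
qed

lemma walk_series_via_eq:
  assumes "b \<in> arcs G"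
  shows "walk_series_via Z i b = fps_X * of_bool (tail G b = i) +
    fps_X * (\<Sum>a\<in>arcs G. walk_series_via Z i a * of_bool (head G a = tail G b \<and> \<not> Z a b))"
proof (rule fps_ext)
  fix n
  show "fps_nth (walk_series_via Z i b) n = fps_nth (fps_X * of_bool (tail G b = i) +
    fps_X * (\<Sum>a\<in>arcs G. walk_series_via Z i a * of_bool (head G a = tail G b \<and> \<not> Z a b))) n"
  proof (cases n)
    case 0
    then show ?thesis
      by (simp add: walk_series_via_def avoiding_walks_via_0)
  next
    case (Suc m)
    show ?thesis
    proof (cases m)
      case 0
      then show ?thesis using Suc assms
        by (simp add: walk_series_via_def fps_sum_nth avoiding_walks_via_0 avoiding_walks_via_1)
    next
      case (Suc l)
      then show ?thesis using \<open>n = Suc m\<close>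
        by (simp add: walk_series_via_def fps_sum_nth card_avoiding_walks_via_Suc_Suc[OF assms]
            fps_mult_of_bool_nth)
    qed
  qed
qed

lemma sum_nth_distinct:
  assumes "distinct xs"
  shows "(\<Sum>k = 0..<length xs. f (xs ! k)) = sum f (set xs)"
  using sum.reindex_bij_betw[OF bij_betw_nth[OF assms refl refl], of f]
  by (simp add: atLeast0LessThan)

text \<open>
  Holds for every relation \<open>Z\<close> on the arrows, as only the splitting of the composable pairs into those
  in \<open>Z\<close> and the others matters.
\<close>

lemma det_walk_series:
  assumes vs: "distinct vs" "set vs = verts G" and as: "distinct as" "set as = arcs G"
  shows "det (kernel_mat (walk_series Z) vs) *
      det (kernel_mat (relation_kernel fps_X (\<lambda>a b. head G a = tail G b \<and> \<not> Z a b)) as) =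
    det (kernel_mat (relation_kernel (- fps_X) (\<lambda>a b. head G a = tail G b \<and> Z a b)) as)"
proof -
  let ?n = "length vs" and ?m = "length as"
  let ?N = "\<lambda>a b. head G a = tail G b \<and> \<not> Z a b"
  let ?Z = "\<lambda>a b. head G a = tail G b \<and> Z a b"
  define U where "U = mat ?n ?m (\<lambda>(r, s). walk_series_via Z (vs ! r) (as ! s))"
  define V :: "int fps mat" where
    "V = mat ?n ?m (\<lambda>(r, s). fps_X * of_bool (tail G (as ! s) = vs ! r))"
  define T :: "int fps mat" where "T = mat ?m ?n (\<lambda>(r, s). of_bool (head G (as ! r) = vs ! s))"
  let ?D = "kernel_mat (relation_kernel (fps_X :: int fps) ?N) as"
  have UT: "1\<^sub>m ?n + U * T = kernel_mat (walk_series Z) vs"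
  proof (rule eq_matI)
    fix r s assume "r < dim_row (kernel_mat (walk_series Z) vs)"
      "s < dim_col (kernel_mat (walk_series Z) vs)"
    then have rs: "r < ?n" "s < ?n" by (auto simp: kernel_mat_def)
    let ?i = "vs ! r" and ?j = "vs ! s"
    have "(U * T) $$ (r, s) =
        (\<Sum>k = 0..<?m. walk_series_via Z ?i (as ! k) * of_bool (head G (as ! k) = ?j))"
      using rs by (simp add: U_def T_def scalar_prod_def)
    also have "\<dots> = (\<Sum>b\<in>arcs G. walk_series_via Z ?i b * of_bool (head G b = ?j))"
      using sum_nth_distinct[OF as(1), of "\<lambda>b. walk_series_via Z ?i b * of_bool (head G b = ?j)"]
      by (simp add: as(2))
    finally show "(1\<^sub>m ?n + U * T) $$ (r, s) = kernel_mat (walk_series Z) vs $$ (r, s)"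
      using rs vs walk_series_eq[of ?i Z ?j] nth_mem[of r vs]
      by (simp add: kernel_mat_def U_def T_def nth_eq_iff_index_eq)
  qed (auto simp: U_def T_def kernel_mat_def)
  have UD: "U * ?D = V"
  proof (rule eq_matI)
    fix r s assume "r < dim_row V" "s < dim_col V"
    then have rs: "r < ?n" "s < ?m" by (auto simp: V_def)
    let ?i = "vs ! r" and ?b = "as ! s"
    let ?w = "walk_series_via Z ?i"
    have b: "?b \<in> arcs G" using nth_mem[OF rs(2)] as(2) by simp
    have "(U * ?D) $$ (r, s) =
        (\<Sum>k = 0..<?m. ?w (as ! k) * relation_kernel fps_X ?N (as ! k) ?b)"
      using rs by (simp add: U_def kernel_mat_def scalar_prod_def)
    also have "\<dots> = (\<Sum>a\<in>arcs G. ?w a * relation_kernel fps_X ?N a ?b)"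
      using sum_nth_distinct[OF as(1), of "\<lambda>a. ?w a * relation_kernel fps_X ?N a ?b"]
      by (simp add: as(2))
    also have "\<dots> = (\<Sum>a\<in>arcs G. ?w a * of_bool (a = ?b)) -
        fps_X * (\<Sum>a\<in>arcs G. ?w a * of_bool (?N a ?b))"
      by (simp only: relation_kernel_def right_diff_distrib sum_subtractf sum_distrib_left
          mult.left_commute)
    also have "(\<Sum>a\<in>arcs G. ?w a * of_bool (a = ?b)) = (\<Sum>a\<in>{?b}. ?w a)"
      by (rule sum.mono_neutral_cong_right) (use b in auto)
    also have "\<dots> = ?w ?b" by simp
    also have "?w ?b - fps_X * (\<Sum>a\<in>arcs G. ?w a * of_bool (?N a ?b)) =
        fps_X * of_bool (tail G ?b = ?i)"
      using walk_series_via_eq[OF b, of Z ?i] by simp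
    finally show "(U * ?D) $$ (r, s) = V $$ (r, s)" using rs by (simp add: V_def)
  qed (auto simp: U_def V_def kernel_mat_def)
  \<comment> \<open>\<open>T V\<close> marks every composable pair with \<open>q\<close>: this cancels \<open>- q\<close> at the pairs outside \<open>Z\<close>
    and leaves \<open>+ q\<close> at the pairs in \<open>Z\<close>.\<close>
  have DTV: "?D + T * V = kernel_mat (relation_kernel (- fps_X) ?Z) as"
  proof (rule eq_matI)
    fix r s assume "r < dim_row (kernel_mat (relation_kernel (- fps_X :: int fps) ?Z) as)"
      "s < dim_col (kernel_mat (relation_kernel (- fps_X :: int fps) ?Z) as)"
    then have rs: "r < ?m" "s < ?m" by (auto simp: kernel_mat_def)
    let ?a = "as ! r" and ?b = "as ! s"
    let ?f = "\<lambda>v. of_bool (head G ?a = v) * (fps_X * of_bool (tail G ?b = v)) :: int fps"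
    have "(T * V) $$ (r, s) = (\<Sum>k = 0..<?n. ?f (vs ! k))"
      using rs by (simp add: T_def V_def scalar_prod_def)
    also have "\<dots> = (\<Sum>v\<in>verts G. ?f v)"
      using sum_nth_distinct[OF vs(1), of ?f] by (simp add: vs(2))
    also have "\<dots> = (\<Sum>v\<in>{head G ?a}. ?f v)"
      by (rule sum.mono_neutral_right) (use nth_mem[OF rs(1)] as(2) in auto)
    finally show "(?D + T * V) $$ (r, s) = kernel_mat (relation_kernel (- fps_X) ?Z) as $$ (r, s)"
      using rs by (auto simp: kernel_mat_def relation_kernel_def T_def V_def)
  qed (auto simp: T_def V_def kernel_mat_def)
  have "det (1\<^sub>m ?n + U * T) * det ?D = det (?D + T * V)"
    by (rule det_one_plus_mult[OF _ _ _ _ UD]) (auto simp: U_def V_def T_def)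
  then show ?thesis unfolding UT DTV .
qed

lemma cas_iff_successively:
  "p \<noteq> [] \<Longrightarrow> cas u p v \<longleftrightarrow>
     tail G (hd p) = u \<and> head G (last p) = v \<and> successively (\<lambda>a b. head G a = tail G b) p"
proof (induction p arbitrary: u)
  case (Cons a p)
  show ?case
  proof (cases "p = []")
    case False
    have "cas u (a # p) v \<longleftrightarrow> tail G a = u \<and> tail G (hd p) = head G a \<and>
        head G (last p) = v \<and> successively (\<lambda>a b. head G a = tail G b) p"
      by (simp only: cas.simps Cons.IH[OF False])
    then show ?thesis
      unfolding successively_Cons list.sel last_ConsR[OF False] using False by metis
  qed (simp add: conj_commute)
qed simp

text \<open>
  The trail condition splits into conditions on cyclically consecutive arrows, so it can be absorbed
  into the relation: minimal cycles become simple cycles of the relation restricted to composable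
  pairs.
\<close>

lemma ex_closed_trail_iff:
  assumes "p \<noteq> []"
  shows "(\<exists>u. trail u p u) \<longleftrightarrow> distinct p \<and> set p \<subseteq> arcs G \<and>
    (\<forall>i < length p. head G (p ! i) = tail G (p ! (Suc i mod length p)))"
proof -
  define l where "l = length p - 1"
  have l: "length p = Suc l" using assms by (simp add: l_def)
  have "(\<forall>i < length p. head G (p ! i) = tail G (p ! (Suc i mod length p))) \<longleftrightarrow>
      successively (\<lambda>a b. head G a = tail G b) p \<and> head G (last p) = tail G (hd p)"
    using assms by (auto simp: successively_conv_nth l All_less_Suc last_conv_nth hd_conv_nth)
  moreover have "tail G (hd p) \<in> verts G" if "set p \<subseteq> arcs G"
    using that assms by (intro tail_in_verts) auto
  ultimately show ?thesis
    using assms by (auto simp: trail_def awalk_def cas_iff_successively)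
qed

lemma minimal_cycles_eq:
  "minimal_cycles G R =
     simple_cycles (\<lambda>a b. head G a = tail G b \<and> R a b) (arcs G) // rotation_rel"
proof -
  have "{p. p \<noteq> [] \<and> (\<exists>u. trail u p u) \<and> (\<forall>i < length p. R (p ! i) (p ! (Suc i mod length p)))} =
      simple_cycles (\<lambda>a b. head G a = tail G b \<and> R a b) (arcs G)"
    unfolding simple_cycles_def using ex_closed_trail_iff by auto
  then show ?thesis
    unfolding minimal_cycles_def rotation_rel_def by simp
qed

end


section \<open>A basis of the quotient by a quadratic monomial ideal\<close>

locale quadratic_monomial_ideal = fin_digraph Q
  for Q :: "('v, 'a) pre_digraph" +
  fixes I :: "(('v, 'a) path \<Rightarrow> 'k::field) set"
    and P :: "('v, 'a) path set"
  assumes P_paths: "P \<subseteq> {x \<in> paths Q. path_length x = 2}"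
    and I_eq: "I = Idl\<^bsub>path_algebra Q\<^esub> (path_elem ` P)"
begin

abbreviation KQ :: "(('v, 'a) path \<Rightarrow> 'k) ring" where "KQ \<equiv> path_algebra Q"

definition zero_pair :: "'a \<Rightarrow> 'a \<Rightarrow> bool" where
  "zero_pair a b \<longleftrightarrow> (tail Q a, [a, b]) \<in> P"

abbreviation nonzero_path :: "'a list \<Rightarrow> bool" where
  "nonzero_path p \<equiv> successively (\<lambda>a b. \<not> zero_pair a b) p"

sublocale KQ: ring KQ
  by (rule ring_path_algebra) (rule fin_digraph_axioms)

lemma KQ_carrier: "f \<in> carrier KQ \<longleftrightarrow> finite {x. f x \<noteq> 0} \<and> {x. f x \<noteq> 0} \<subseteq> paths Q"
  by (simp add: path_algebra_def)

lemma KQ_carrierI: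
  assumes "{x. f x \<noteq> 0} \<subseteq> F" "finite F" "F \<subseteq> paths Q"
  shows "f \<in> carrier KQ"
  using finite_subset[OF assms(1,2)] order_trans[OF assms(1,3)] by (simp add: KQ_carrier)

lemma KQ_add: "(f \<oplus>\<^bsub>KQ\<^esub> g) x = f x + g x" and KQ_zero: "\<zero>\<^bsub>KQ\<^esub> = (\<lambda>x. 0)"
  and KQ_one: "\<one>\<^bsub>KQ\<^esub> = scalar_elem Q 1"
  by (simp_all add: path_algebra_def)

lemma KQ_uminus:
  assumes "f \<in> carrier KQ" shows "\<ominus>\<^bsub>KQ\<^esub> f = (\<lambda>x. - f x)"
proof -
  have "(\<lambda>x. - f x) \<in> carrier KQ" using assms by (simp add: KQ_carrier)
  moreover have "(\<lambda>x. - f x) \<oplus>\<^bsub>KQ\<^esub> f = \<zero>\<^bsub>KQ\<^esub>" by (rule ext) (simp add: KQ_add KQ_zero)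
  ultimately show ?thesis using assms KQ.minus_equality by blast
qed

lemma KQ_minus:
  assumes "f \<in> carrier KQ" "g \<in> carrier KQ" shows "(f \<ominus>\<^bsub>KQ\<^esub> g) x = f x - g x"
  using assms by (simp add: a_minus_def KQ_uminus KQ_add)

lemmas KQ_mult_nth = path_algebra_mult_nth[OF wf_digraph_axioms, where ?'c = 'k]

lemma path_elem_closed: "x \<in> paths Q \<Longrightarrow> path_elem x \<in> carrier KQ"
  by (simp add: KQ_carrier path_elem_def)

lemma path_elem_mult:
  "path_elem x \<otimes>\<^bsub>KQ\<^esub> path_elem y =
     (if path_target Q x = path_source y then path_elem (path_concat x y) else \<zero>\<^bsub>KQ\<^esub>)"
  by (rule ext) (simp add: path_algebra_def path_elem_def)

lemma scalar_mult: "f \<in> carrier KQ \<Longrightarrow> scalar_elem Q c \<otimes>\<^bsub>KQ\<^esub> f = (\<lambda>x. c * f x)"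
  by (rule path_algebra_scalar_mult(1)[OF fin_digraph_axioms])

lemma scalar_closed: "scalar_elem Q c \<in> carrier KQ"
  by (rule scalar_elem_closed) (rule fin_digraph_axioms)

text \<open>
  The explicit form of \<open>I\<close>: combinations of paths that contain a generator.
\<close>

definition vanishing :: "(('v, 'a) path \<Rightarrow> 'k) set" where
  "vanishing = {f \<in> carrier KQ. \<forall>u p. f (u, p) \<noteq> 0 \<longrightarrow> \<not> nonzero_path p}"

lemma KQ_mult_nonzeroD:
  assumes "f \<in> carrier KQ" "g \<in> carrier KQ" "(f \<otimes>\<^bsub>KQ\<^esub> g) (u, p) \<noteq> 0"
  obtains q v r where "p = q @ r" "f (u, q) \<noteq> 0" "g (v, r) \<noteq> 0"
proof -
  from assms(3) obtain k where "f (u, take k p) * g (awlast u (take k p), drop k p) \<noteq> 0"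
    unfolding KQ_mult_nth[OF assms(1,2)] using sum.not_neutral_contains_not_neutral by blast
  then show ?thesis using that[of "take k p" "drop k p"] by auto
qed

lemma ideal_vanishing: "ideal vanishing KQ"
proof (rule idealI[OF KQ.ring_axioms])
  show "subgroup vanishing (add_monoid KQ)"
  proof (rule KQ.add.subgroupI)
    show "vanishing \<noteq> {}"
      using KQ.zero_closed by (auto simp: vanishing_def KQ_zero)
    show "a \<oplus>\<^bsub>KQ\<^esub> b \<in> vanishing" if "a \<in> vanishing" "b \<in> vanishing" for a b
    proof -
      have "a \<oplus>\<^bsub>KQ\<^esub> b \<in> carrier KQ" using that by (auto simp: vanishing_def)
      moreover have "a (u, p) = 0" "b (u, p) = 0" if "nonzero_path p" for u p
        using that \<open>a \<in> vanishing\<close> \<open>b \<in> vanishing\<close> by (auto simp: vanishing_def)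
      ultimately show ?thesis by (auto simp: vanishing_def KQ_add)
    qed
    show "\<ominus>\<^bsub>KQ\<^esub> a \<in> vanishing" if "a \<in> vanishing" for a
    proof -
      have "a \<in> carrier KQ" using that by (auto simp: vanishing_def)
      then show ?thesis using that KQ.a_inv_closed[of a] by (auto simp: vanishing_def KQ_uminus)
    qed
  qed (auto simp: vanishing_def)
next
  fix f g assume f: "f \<in> vanishing" and g: "g \<in> carrier KQ"
  then have f': "f \<in> carrier KQ" by (simp add: vanishing_def)
  have "\<not> nonzero_path p" if "(g \<otimes>\<^bsub>KQ\<^esub> f) (u, p) \<noteq> 0" for u p
    by (rule KQ_mult_nonzeroD[OF g f' that])
       (use f in \<open>auto simp: vanishing_def successively_append_iff\<close>)
  then show "g \<otimes>\<^bsub>KQ\<^esub> f \<in> vanishing" using f' g by (auto simp: vanishing_def)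
  have "\<not> nonzero_path p" if "(f \<otimes>\<^bsub>KQ\<^esub> g) (u, p) \<noteq> 0" for u p
    by (rule KQ_mult_nonzeroD[OF f' g that])
       (use f in \<open>auto simp: vanishing_def successively_append_iff\<close>)
  then show "f \<otimes>\<^bsub>KQ\<^esub> g \<in> vanishing" using f' g by (auto simp: vanishing_def)
qed

lemma P_form:
  assumes "x \<in> P"
  obtains a b where "x = (tail Q a, [a, b])" "zero_pair a b"
proof -
  obtain u p v where x: "x = (u, p)" "awalk u p v" "length p = 2"
    using assms P_paths by (auto simp: paths_def path_length_def)
  then obtain a b where "p = [a, b]" by (auto simp: length_Suc_conv numeral_2_eq_2)
  then show ?thesis using x assms that[of a b] by (auto simp: zero_pair_def awalk_simps)
qed

lemma generators_closed: "path_elem ` P \<subseteq> carrier KQ"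
  using P_paths by (auto intro!: path_elem_closed)

lemma ideal_I: "ideal I KQ"
  unfolding I_eq by (rule KQ.genideal_ideal[OF generators_closed])

lemma not_nonzero_path_split:
  assumes "\<not> nonzero_path p"
  obtains q a b r where "p = q @ [a, b] @ r" "zero_pair a b"
proof -
  obtain k where k: "Suc k < length p" "zero_pair (p ! k) (p ! Suc k)"
    using assms by (auto simp: successively_conv_nth)
  have "p = take k p @ [p ! k, p ! Suc k] @ drop (Suc (Suc k)) p"
    using k by (simp add: Cons_nth_drop_Suc)
  then show ?thesis using that k by blast
qed

text \<open>
  A path containing a generator is the product of an initial path, the generator, and a final path.
\<close>

lemma path_elem_in_I:
  assumes x: "(u, p) \<in> paths Q" and nz: "\<not> nonzero_path p"
  shows "path_elem (u, p) \<in> I"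
proof -
  obtain q a b r where p: "p = q @ [a, b] @ r" and ab: "zero_pair a b"
    using not_nonzero_path_split[OF nz] .
  have P: "path_elem (tail Q a, [a, b]) \<in> I"
    using ab KQ.genideal_self[OF generators_closed] unfolding I_eq zero_pair_def by blast
  obtain v where w: "awalk u (q @ [a, b] @ r) v" using x by (auto simp: paths_def p)
  then have q: "awalk u q (tail Q a)" and r: "awalk (head Q b) r v" and h: "head Q a = tail Q b"
    by (auto simp: awalk_append_iff awalk_simps)
  interpret I: ideal I KQ by (rule ideal_I)
  have "path_elem (u, q) \<otimes>\<^bsub>KQ\<^esub> path_elem (tail Q a, [a, b]) \<otimes>\<^bsub>KQ\<^esub> path_elem (head Q b, r) \<in> I"
    by (intro I.I_l_closed I.I_r_closed P path_elem_closed) (use q r in \<open>auto simp: paths_def\<close>)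
  also have "path_elem (u, q) \<otimes>\<^bsub>KQ\<^esub> path_elem (tail Q a, [a, b]) = path_elem (u, q @ [a, b])"
    using q by (auto simp: path_elem_mult path_target_def path_source_def path_concat_def)
  also have "path_elem (u, q @ [a, b]) \<otimes>\<^bsub>KQ\<^esub> path_elem (head Q b, r) = path_elem (u, p)"
    by (auto simp: path_elem_mult path_target_def path_source_def path_concat_def p awalk_verts_conv)
  finally show ?thesis .
qed

lemma I_eq_vanishing: "I = vanishing"
proof
  have "path_elem x \<in> vanishing" if x: "x \<in> P" for x
  proof -
    obtain a b where "x = (tail Q a, [a, b])" "zero_pair a b" using P_form[OF x] .
    moreover have "path_elem x \<in> carrier KQ" using x generators_closed by blast
    ultimately show ?thesis by (auto simp: vanishing_def path_elem_def)
  qed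
  then show "I \<subseteq> vanishing"
    unfolding I_eq by (intro KQ.genideal_minimal ideal_vanishing) auto
next
  interpret I: ideal I KQ by (rule ideal_I)
  \<comment> \<open>An element of the path algebra is the sum of its finitely many terms; they are split off
    one at a time.\<close>
  have in_I: "f \<in> I" if "finite F" "{x. f x \<noteq> 0} \<subseteq> F" "F \<subseteq> {(u, p) \<in> paths Q. \<not> nonzero_path p}" for F f
    using that
  proof (induction F arbitrary: f rule: finite_induct)
    case empty
    then have "f = \<zero>\<^bsub>KQ\<^esub>" by (auto simp: KQ_zero)
    then show ?case by simp
  next
    case (insert x F)
    obtain u p where x: "x = (u, p)" by (cases x)
    have "f(x := 0) \<in> I" by (rule insert.IH) (use insert.prems in auto)
    moreover have "scalar_elem Q (f x) \<otimes>\<^bsub>KQ\<^esub> path_elem x \<in> I"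
      unfolding x by (intro I.I_l_closed scalar_closed path_elem_in_I) (use insert.prems x in auto)
    ultimately have "scalar_elem Q (f x) \<otimes>\<^bsub>KQ\<^esub> path_elem x \<oplus>\<^bsub>KQ\<^esub> f(x := 0) \<in> I"
      by (intro I.a_closed)
    also have "scalar_elem Q (f x) \<otimes>\<^bsub>KQ\<^esub> path_elem x \<oplus>\<^bsub>KQ\<^esub> f(x := 0) = f"
    proof
      have "path_elem x \<in> carrier KQ" using insert.prems by (intro path_elem_closed) auto
      then show "(scalar_elem Q (f x) \<otimes>\<^bsub>KQ\<^esub> path_elem x \<oplus>\<^bsub>KQ\<^esub> f(x := 0)) y = f y" for y
        by (auto simp: KQ_add scalar_mult path_elem_def)
    qed
    finally show ?case .
  qed
  show "vanishing \<subseteq> I"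
  proof
    fix f assume "f \<in> vanishing"
    then have "finite {x. f x \<noteq> 0}" "{x. f x \<noteq> 0} \<subseteq> {(u, p) \<in> paths Q. \<not> nonzero_path p}"
      by (auto simp: vanishing_def KQ_carrier)
    then show "f \<in> I" using in_I[of "{x. f x \<noteq> 0}" f] by simp
  qed
qed

lemma arrow_product_in_iff:
  assumes "a \<in> arcs Q" "b \<in> arcs Q" "head Q a = tail Q b"
  shows "arrow_product_in Q I a b \<longleftrightarrow> zero_pair a b"
proof -
  have eq: "(arrow_elem Q a :: _ \<Rightarrow> 'k) \<otimes>\<^bsub>KQ\<^esub> arrow_elem Q b = path_elem (tail Q a, [a, b])"
    using assms(3) by (simp add: path_elem_mult path_target_def path_source_def path_concat_def)
  have "(tail Q a, [a, b]) \<in> paths Q"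
    using assms by (auto simp: paths_def awalk_simps)
  then have "path_elem (tail Q a, [a, b]) \<in> carrier KQ" by (rule path_elem_closed)
  then show ?thesis
    unfolding arrow_product_in_def eq I_eq_vanishing vanishing_def
    by (auto simp: path_elem_def)
qed

text \<open>
  Linear independence in the quotient: the coefficients at the nonzero paths are invariants of a
  residue class.
\<close>

lemma residue_class_eq_iff:
  assumes f: "f \<in> carrier KQ" and g: "g \<in> carrier KQ"
  shows "residue_class Q I f = residue_class Q I g \<longleftrightarrow>
    (\<forall>u p. nonzero_path p \<longrightarrow> f (u, p) = g (u, p))"
proof -
  have "residue_class Q I f = residue_class Q I g \<longleftrightarrow> f \<ominus>\<^bsub>KQ\<^esub> g \<in> I"
    unfolding residue_class_def using KQ.quotient_eq_iff_same_a_r_cos[OF ideal_I f g] by simp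
  also have "\<dots> \<longleftrightarrow> (\<forall>u p. nonzero_path p \<longrightarrow> f (u, p) = g (u, p))"
    unfolding I_eq_vanishing vanishing_def using f g by (auto simp: KQ_minus)
  finally show ?thesis .
qed

abbreviation A :: "(('v, 'a) path \<Rightarrow> 'k) set ring" where "A \<equiv> quiver_algebra Q I"

sublocale A: ring A
  unfolding quiver_algebra_def by (rule ideal.quotient_is_ring[OF ideal_I])

sublocale residue: ring_hom_ring KQ A "residue_class Q I"
  using ideal.rcos_ring_hom_ring[OF ideal_I]
  unfolding quiver_algebra_def residue_class_def[abs_def] .

lemma carrier_A: "carrier A = residue_class Q I ` carrier KQ"
  unfolding quiver_algebra_def residue_class_def FactRing_def A_RCOSETS_def' a_r_coset_def' by auto

text \<open>
  A vertex is needed: otherwise \<open>1 = 0\<close> in \<open>A\<close>. The dimension over the ground field is well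
  defined only over a subfield.
\<close>

lemma subfield_ground_field:
  assumes "i \<in> verts Q"
  shows "subfield (ground_field Q I) A"
proof -
  let ?s = "scalar_elem Q :: 'k \<Rightarrow> _" and ?S = "range (scalar_elem Q :: 'k \<Rightarrow> _)"
  have nth: "scalar_elem Q c (i, []) = c" for c :: 'k using assms by (simp add: scalar_elem_def)
  have mult: "?s c \<otimes>\<^bsub>KQ\<^esub> ?s d = ?s (c * d)" for c d
    unfolding scalar_mult[OF scalar_closed]
    by (rule ext) (auto simp: scalar_elem_def split: prod.split)
  have add: "?s c \<oplus>\<^bsub>KQ\<^esub> ?s d = ?s (c + d)" for c d
    by (rule ext) (auto simp: KQ_add scalar_elem_def split: prod.split)
  have minus: "\<ominus>\<^bsub>KQ\<^esub> ?s c = ?s (- c)" for c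
    unfolding KQ_uminus[OF scalar_closed]
    by (rule ext) (auto simp: scalar_elem_def split: prod.split)
  have zero: "\<zero>\<^bsub>KQ\<^esub> = ?s 0"
    by (rule ext) (auto simp: KQ_zero scalar_elem_def split: prod.split)
  have inj: "?s c = ?s d \<longleftrightarrow> c = d" for c d using nth by metis
  have "subring ?S KQ"
    by (rule KQ.subringI) (auto simp: scalar_closed KQ_one minus mult add)
  then have "subcring ?S KQ"
    by (rule KQ.subcringI) (auto simp: mult mult.commute)
  moreover have "Units (KQ \<lparr> carrier := ?S \<rparr>) = ?S - {\<zero>\<^bsub>KQ\<^esub>}"
  proof -
    have "(\<exists>d. d * c = 1 \<and> c * d = 1) \<longleftrightarrow> c \<noteq> 0" for c :: 'k
      by (auto intro: exI[of _ "inverse c"])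
    then show ?thesis
      by (auto simp: Units_def KQ_one mult zero inj)
  qed
  ultimately have "subfield ?S KQ" by (rule KQ.subfieldI)
  moreover have "\<one>\<^bsub>A\<^esub> \<noteq> \<zero>\<^bsub>A\<^esub>"
  proof
    assume "\<one>\<^bsub>A\<^esub> = \<zero>\<^bsub>A\<^esub>"
    then have "residue_class Q I \<one>\<^bsub>KQ\<^esub> = residue_class Q I \<zero>\<^bsub>KQ\<^esub>"
      by simp
    then have "(\<one>\<^bsub>KQ\<^esub> :: _ \<Rightarrow> 'k) (i, []) = \<zero>\<^bsub>KQ\<^esub> (i, [])"
      by (subst (asm) residue_class_eq_iff) auto
    then show False by (simp add: KQ_one zero nth)
  qed
  ultimately have "subfield (residue_class Q I ` ?S) A"
    by (rule residue.img_is_subfield(2))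
  then show ?thesis by (simp add: ground_field_def image_image)
qed

text \<open>
  Distinct nonzero paths have linearly independent residue classes; each path added to the set
  enlarges the span by one dimension, since its own coefficient tells it apart from the previous span.
\<close>

lemma dimension_span_nonzero_paths:
  assumes "finite F" "F \<subseteq> {(u, p) \<in> paths Q. nonzero_path p}"
  shows "A.dimension (card F) (ground_field Q I) (residue_class Q I ` {f. {x. f x \<noteq> 0} \<subseteq> F})"
  using assms
proof (induction F rule: finite_induct)
  case empty
  have "{f :: _ \<Rightarrow> 'k. {x. f x \<noteq> 0} \<subseteq> {}} = {\<zero>\<^bsub>KQ\<^esub>}" by (auto simp: KQ_zero)
  then show ?case by simp
next
  case (insert x F)
  let ?span = "\<lambda>F. residue_class Q I ` {f. {x. f x \<noteq> 0} \<subseteq> F}"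
  obtain u p where x: "x = (u, p)" by (cases x)
  have px: "path_elem x \<in> carrier KQ" using insert.prems by (intro path_elem_closed) auto
  have supp: "f \<in> carrier KQ" if "{x. f x \<noteq> 0} \<subseteq> F" for f :: "_ \<Rightarrow> 'k"
    by (rule KQ_carrierI[OF that]) (use insert in auto)
  have comb: "residue_class Q I (scalar_elem Q c) \<otimes>\<^bsub>A\<^esub> residue_class Q I (path_elem x) \<oplus>\<^bsub>A\<^esub>
      residue_class Q I f = residue_class Q I (\<lambda>y. c * path_elem x y + f y)"
    if "{x. f x \<noteq> 0} \<subseteq> F" for c f
  proof -
    have "scalar_elem Q c \<otimes>\<^bsub>KQ\<^esub> path_elem x \<oplus>\<^bsub>KQ\<^esub> f = (\<lambda>y. c * path_elem x y + f y)"
      by (rule ext) (simp add: KQ_add scalar_mult px)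
    then show ?thesis
      using supp[OF that] px scalar_closed[of c] by (simp flip: residue.hom_add residue.hom_mult)
  qed
  have "residue_class Q I (path_elem x) \<notin> ?span F"
  proof
    assume "residue_class Q I (path_elem x) \<in> ?span F"
    then obtain f where f: "{x. f x \<noteq> 0} \<subseteq> F" "residue_class Q I (path_elem x) = residue_class Q I f"
      by blast
    then have "path_elem x x = f x"
      using residue_class_eq_iff[OF px supp[OF f(1)]] insert.prems x by auto
    moreover have "f x = 0" using f(1) insert.hyps by blast
    ultimately show False by (simp add: path_elem_def)
  qed
  then have "A.dimension (Suc (card F)) (ground_field Q I)
      (A.line_extension (ground_field Q I) (residue_class Q I (path_elem x)) (?span F))"
    using px insert by (intro A.Suc_dim) auto
  also have "A.line_extension (ground_field Q I) (residue_class Q I (path_elem x)) (?span F) =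
      ?span (insert x F)"
  proof (intro equalityI subsetI)
    fix a assume "a \<in> A.line_extension (ground_field Q I) (residue_class Q I (path_elem x)) (?span F)"
    then obtain c f where "{x. f x \<noteq> 0} \<subseteq> F"
      "a = residue_class Q I (\<lambda>y. c * path_elem x y + f y)"
      unfolding A.line_extension_mem_iff ground_field_def using comb by auto
    moreover from this have "{y. c * path_elem x y + f y \<noteq> 0} \<subseteq> insert x F"
      by (auto simp: path_elem_def)
    ultimately show "a \<in> ?span (insert x F)" by blast
  next
    fix a assume "a \<in> ?span (insert x F)"
    then obtain f where f: "{y. f y \<noteq> 0} \<subseteq> insert x F" "a = residue_class Q I f" by blast
    have "f = (\<lambda>y. f x * path_elem x y + (f(x := 0)) y)" by (auto simp: path_elem_def)
    then have a: "a = residue_class Q I (\<lambda>y. f x * path_elem x y + (f(x := 0)) y)"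
      using f(2) by simp
    have sub: "{y. (f(x := 0)) y \<noteq> 0} \<subseteq> F" using f(1) by auto
    have "residue_class Q I (scalar_elem Q (f x)) \<in> ground_field Q I"
      "residue_class Q I (f(x := 0)) \<in> ?span F"
      using sub unfolding ground_field_def by blast+
    then show "a \<in> A.line_extension (ground_field Q I) (residue_class Q I (path_elem x)) (?span F)"
      unfolding A.line_extension_mem_iff a comb[OF sub, symmetric] by blast
  qed
  finally show ?case using insert.hyps by simp
qed

lemma vertex_elem_mult:
  assumes f: "f \<in> carrier KQ" and i: "i \<in> verts Q"
  shows "(vertex_elem i \<otimes>\<^bsub>KQ\<^esub> f) (u, p) = (if u = i then f (u, p) else 0)"
proof -
  have e: "vertex_elem i \<in> carrier KQ"
    using i by (intro path_elem_closed) (auto simp: paths_def awalk_simps)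
  have "(vertex_elem i \<otimes>\<^bsub>KQ\<^esub> f) (u, p) =
      (\<Sum>k\<le>length p. if k = 0 then if u = i then f (u, p) else 0 else 0)"
    unfolding KQ_mult_nth[OF e f]
    by (intro sum.cong refl) (auto simp: path_elem_def)
  then show ?thesis by simp
qed

lemma mult_vertex_elem:
  assumes f: "f \<in> carrier KQ" and j: "j \<in> verts Q"
  shows "(f \<otimes>\<^bsub>KQ\<^esub> vertex_elem j) (u, p) = (if awlast u p = j then f (u, p) else 0)"
proof -
  have e: "vertex_elem j \<in> carrier KQ"
    using j by (intro path_elem_closed) (auto simp: paths_def awalk_simps)
  have "(f \<otimes>\<^bsub>KQ\<^esub> vertex_elem j) (u, p) =
      (\<Sum>k\<le>length p. if k = length p then if awlast u p = j then f (u, p) else 0 else 0)"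
    unfolding KQ_mult_nth[OF f e]
    by (intro sum.cong refl) (auto simp: path_elem_def)
  then show ?thesis by simp
qed

text \<open>
  Multiplying by the two vertices restricts an element to the paths from \<open>i\<close> to \<open>j\<close>. Membership in
  the degree part is witnessed by a possibly different representative, which has the same coefficients
  at the nonzero paths; so deleting the terms at zero paths from the restricted element yields a
  representative that satisfies both conditions.
\<close>

lemma corner_part_eq:
  assumes i: "i \<in> verts Q" and j: "j \<in> verts Q"
  shows "corner_part Q I i j n =
    residue_class Q I ` {f. {x. f x \<noteq> 0} \<subseteq> Pair i ` avoiding_walks Q zero_pair i j n}"
    (is "_ = ?span")
proof -
  let ?c = "\<lambda>f. vertex_elem i \<otimes>\<^bsub>KQ\<^esub> f \<otimes>\<^bsub>KQ\<^esub> vertex_elem j"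
  have e: "vertex_elem k \<in> carrier KQ" if "k \<in> verts Q" for k
    using that by (intro path_elem_closed) (auto simp: paths_def awalk_simps)
  have corner: "?c f (u, p) = (if u = i \<and> awlast u p = j then f (u, p) else 0)"
    if "f \<in> carrier KQ" for f u p
    using that e[OF i] by (simp add: mult_vertex_elem[OF _ j] vertex_elem_mult[OF _ i])
  have supp: "f \<in> carrier KQ" if "{x. f x \<noteq> 0} \<subseteq> Pair i ` avoiding_walks Q zero_pair i j n"
    for f :: "_ \<Rightarrow> 'k"
    by (rule KQ_carrierI[OF that])
       (auto simp: finite_avoiding_walks, auto simp: avoiding_walks_def paths_def)
  have hom: "residue_class Q I (vertex_elem i) \<otimes>\<^bsub>A\<^esub> residue_class Q I f \<otimes>\<^bsub>A\<^esub>
      residue_class Q I (vertex_elem j) = residue_class Q I (?c f)" if "f \<in> carrier KQ" for f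
    using that e[OF i] e[OF j] by simp
  show ?thesis
  proof (intro equalityI subsetI)
    fix a assume "a \<in> corner_part Q I i j n"
    then obtain f g where f: "f \<in> carrier KQ" "a = residue_class Q I (?c f)"
      and g: "g \<in> carrier KQ" "a = residue_class Q I g" "\<And>x. g x \<noteq> 0 \<Longrightarrow> path_length x = n"
      by (auto simp: corner_part_def carrier_A degree_part_def hom)
    define h where "h = (\<lambda>x. if nonzero_path (snd x) then ?c f x else 0)"
    have cf: "?c f \<in> carrier KQ" using f(1) e[OF i] e[OF j] by simp
    have h: "h \<in> carrier KQ"
      by (rule KQ_carrierI[of _ "{x. ?c f x \<noteq> 0}"]) (use cf in \<open>auto simp: h_def KQ_carrier\<close>)
    have "a = residue_class Q I h"
      unfolding f(2) using residue_class_eq_iff[OF cf h] by (auto simp: h_def)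
    moreover have "x \<in> Pair i ` avoiding_walks Q zero_pair i j n" if "h x \<noteq> 0" for x
    proof -
      obtain u p where x: "x = (u, p)" by (cases x)
      have nz: "nonzero_path p" "?c f (u, p) \<noteq> 0"
        using that by (auto simp: h_def x split: if_splits)
      have "g (u, p) \<noteq> 0"
        using residue_class_eq_iff[OF cf g(1)] f(2) g(2) nz by auto
      then have len: "length p = n" using g(3) by (force simp: path_length_def)
      have uv: "u = i" "awlast u p = j" "f (u, p) \<noteq> 0"
        using nz(2) unfolding corner[OF f(1)] by (auto split: if_splits)
      then obtain v where "awalk u p v" using f(1) by (auto simp: KQ_carrier paths_def)
      then have "awalk i p j" using uv by auto
      then show ?thesis using len nz(1) uv(1) by (auto simp: x avoiding_walks_def)
    qed
    ultimately show "a \<in> ?span" by blast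
  next
    fix a assume "a \<in> ?span"
    then obtain f where f: "{x. f x \<noteq> 0} \<subseteq> Pair i ` avoiding_walks Q zero_pair i j n"
      "a = residue_class Q I f" by blast
    note fc = supp[OF f(1)]
    have "?c f = f"
    proof (rule ext)
      fix x :: "('v, 'a) path"
      obtain u p where x: "x = (u, p)" by (cases x)
      have "u = i \<and> awlast u p = j" if "f (u, p) \<noteq> 0"
        using that f(1) by (auto simp: avoiding_walks_def)
      then show "?c f x = f x" unfolding x corner[OF fc] by auto
    qed
    then have "a = residue_class Q I (vertex_elem i) \<otimes>\<^bsub>A\<^esub> residue_class Q I f \<otimes>\<^bsub>A\<^esub>
      residue_class Q I (vertex_elem j)" using hom[OF fc] f(2) by simp
    moreover have "residue_class Q I f \<in> carrier A" using fc by simp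
    moreover have "a \<in> degree_part Q I n"
      using f fc by (auto simp: degree_part_def avoiding_walks_def path_length_def)
    ultimately show "a \<in> corner_part Q I i j n" unfolding corner_part_def by blast
  qed
qed

lemma dim_corner_part:
  assumes i: "i \<in> verts Q" and j: "j \<in> verts Q"
  shows "A.dim (ground_field Q I) (corner_part Q I i j n) = card (avoiding_walks Q zero_pair i j n)"
proof -
  let ?F = "Pair i ` avoiding_walks Q zero_pair i j n"
  have "?F \<subseteq> {(u, p) \<in> paths Q. nonzero_path p}"
    by (auto simp: avoiding_walks_def paths_def)
  then have "A.dimension (card ?F) (ground_field Q I) (corner_part Q I i j n)"
    unfolding corner_part_eq[OF assms]
    by (intro dimension_span_nonzero_paths finite_imageI finite_avoiding_walks)
  from A.dimI[OF subfield_ground_field[OF i] this]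
  show ?thesis by (simp add: over_def card_image inj_on_def)
qed

section \<open>The determinant of the q-Cartan matrix\<close>

text \<open>
  A product of two arrows that do not compose is \<open>0\<close> and thus lies in \<open>I\<close>, although the pair is not a
  generator; the two notions agree on the composable pairs, and only these occur in cycles.
\<close>

lemma minimal_cycles_arrow_product_in:
  "zero_cycles Q I =
     simple_cycles (\<lambda>a b. head Q a = tail Q b \<and> zero_pair a b) (arcs Q) // rotation_rel"
  "nonzero_cycles Q I =
     simple_cycles (\<lambda>a b. head Q a = tail Q b \<and> \<not> zero_pair a b) (arcs Q) // rotation_rel"
proof -
  have cong: "simple_cycles R (arcs Q) = simple_cycles R' (arcs Q)"
    if eq: "\<And>a b. a \<in> arcs Q \<Longrightarrow> b \<in> arcs Q \<Longrightarrow> R a b \<longleftrightarrow> R' a b" for R R'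
  proof -
    have "R (p ! i) (p ! (Suc i mod length p)) \<longleftrightarrow> R' (p ! i) (p ! (Suc i mod length p))"
      if "set p \<subseteq> arcs Q" "i < length p" for p i
    proof -
      have "p ! i \<in> arcs Q" "p ! (Suc i mod length p) \<in> arcs Q"
        by (rule subsetD[OF that(1)], intro nth_mem mod_less_divisor, use that(2) in linarith)+
      then show ?thesis by (rule eq)
    qed
    then show ?thesis unfolding simple_cycles_def by blast
  qed
  show "zero_cycles Q I =
     simple_cycles (\<lambda>a b. head Q a = tail Q b \<and> zero_pair a b) (arcs Q) // rotation_rel"
    unfolding zero_cycles_def minimal_cycles_eq
    by (rule arg_cong[of _ _ "\<lambda>S. S // rotation_rel"], rule cong)
       (auto simp: arrow_product_in_iff)
  show "nonzero_cycles Q I =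
     simple_cycles (\<lambda>a b. head Q a = tail Q b \<and> \<not> zero_pair a b) (arcs Q) // rotation_rel"
    unfolding nonzero_cycles_def minimal_cycles_eq
    by (rule arg_cong[of _ _ "\<lambda>S. S // rotation_rel"], rule cong)
       (auto simp: arrow_product_in_iff)
qed

lemma q_cartan_matrix_eq:
  assumes "set vs = verts Q"
  shows "q_cartan_matrix Q I vs = kernel_mat (walk_series zero_pair) vs"
proof (rule eq_matI)
  fix r s assume "r < dim_row (kernel_mat (walk_series zero_pair) vs)"
    "s < dim_col (kernel_mat (walk_series zero_pair) vs)"
  then have rs: "r < length vs" "s < length vs" by (auto simp: kernel_mat_def)
  then have "vs ! r \<in> verts Q" "vs ! s \<in> verts Q" using assms nth_mem by blast+
  then show "q_cartan_matrix Q I vs $$ (r, s) = kernel_mat (walk_series zero_pair) vs $$ (r, s)"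
    using rs by (simp add: q_cartan_matrix_def kernel_mat_def q_cartan_def walk_series_def
        dim_corner_part)
qed (auto simp: q_cartan_matrix_def kernel_mat_def)

lemma det_q_cartan_matrix:
  assumes vs: "distinct vs" "set vs = verts Q"
    and right: "\<And>a. a \<in> arcs Q \<Longrightarrow> card {b \<in> arcs Q. head Q a = tail Q b \<and> zero_pair a b} \<le> 1"
      "\<And>a. a \<in> arcs Q \<Longrightarrow> card {b \<in> arcs Q. head Q a = tail Q b \<and> \<not> zero_pair a b} \<le> 1"
  shows "det (q_cartan_matrix Q I vs) * (\<Prod>C \<in> nonzero_cycles Q I. 1 - fps_X ^ cycle_length C) =
    (\<Prod>C \<in> zero_cycles Q I. 1 - (- fps_X) ^ cycle_length C)"
proof -
  obtain as where as: "distinct as" "set as = arcs Q"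
    using finite_distinct_list[OF finite_arcs] by blast
  have functional: "b = c"
    if "card {b \<in> arcs Q. R a b} \<le> 1" "b \<in> arcs Q" "c \<in> arcs Q" "R a b" "R a c" for R a b c
    using that card_le_Suc0_iff_eq[of "{b \<in> arcs Q. R a b}"] by auto
  let ?Z = "\<lambda>a b. head Q a = tail Q b \<and> zero_pair a b"
  let ?N = "\<lambda>a b. head Q a = tail Q b \<and> \<not> zero_pair a b"
  have "det (kernel_mat (relation_kernel (- fps_X :: int fps) ?Z) as) =
      (\<Prod>C \<in> zero_cycles Q I. 1 - (- fps_X) ^ cycle_length C)"
    unfolding minimal_cycles_arrow_product_in
  proof (rule det_relation_kernel[OF as])
    show "b = c" if "a \<in> arcs Q" "b \<in> arcs Q" "c \<in> arcs Q" "?Z a b" "?Z a c" for a b c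
      by (rule functional[of ?Z a, OF right(1)]) (use that in auto)
  qed
  moreover have "det (kernel_mat (relation_kernel (fps_X :: int fps) ?N) as) =
      (\<Prod>C \<in> nonzero_cycles Q I. 1 - fps_X ^ cycle_length C)"
    unfolding minimal_cycles_arrow_product_in
  proof (rule det_relation_kernel[OF as])
    show "b = c" if "a \<in> arcs Q" "b \<in> arcs Q" "c \<in> arcs Q" "?N a b" "?N a c" for a b c
      by (rule functional[of ?N a, OF right(2)]) (use that in auto)
  qed
  ultimately show ?thesis
    using det_walk_series[OF vs as, of zero_pair] by (simp add: q_cartan_matrix_eq[OF vs(2)])
qed

end

theorem corollary1:
  fixes Q :: "('v, 'a) pre_digraph"
    and I :: "(('v, 'a) path \<Rightarrow> 'k::field) set"
    and vs :: "'v list"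
  assumes "locally_gentle_quiver Q I"
    and "distinct vs" and "set vs = verts Q"
  shows "to_fract (det (q_cartan_matrix Q I vs)) =
           to_fract (\<Prod>C \<in> zero_cycles Q I. 1 - (- fps_X) ^ cycle_length C) /
           to_fract (\<Prod>C \<in> nonzero_cycles Q I. 1 - fps_X ^ cycle_length C)"
proof -
  interpret lg: locally_gentle_quiver Q I by fact
  obtain P where "P \<subseteq> {x \<in> paths Q. path_length x = 2}"
    "I = Idl\<^bsub>path_algebra Q\<^esub> (path_elem ` P)"
    using lg.generated by blast
  then interpret quadratic_monomial_ideal Q I P by unfold_locales
  let ?num = "\<Prod>C \<in> zero_cycles Q I. 1 - (- fps_X) ^ cycle_length C :: int fps"
  let ?den = "\<Prod>C \<in> nonzero_cycles Q I. 1 - fps_X ^ cycle_length C :: int fps"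
  \<comment> \<open>Among the arrows composable with a given one, at most one has a zero and at most one a nonzero
    product with it.\<close>
  have "det (q_cartan_matrix Q I vs) * ?den = ?num"
  proof (rule det_q_cartan_matrix[OF assms(2,3)])
    fix a assume a: "a \<in> arcs Q"
    have "{b \<in> arcs Q. head Q a = tail Q b \<and> zero_pair a b} =
        {b \<in> arcs Q. head Q a = tail Q b \<and> arrow_product_in Q I a b}"
      using a arrow_product_in_iff by blast
    then show "card {b \<in> arcs Q. head Q a = tail Q b \<and> zero_pair a b} \<le> 1"
      using lg.rel_right[OF a] by simp
    have "{b \<in> arcs Q. head Q a = tail Q b \<and> \<not> zero_pair a b} \<subseteq>
        {b \<in> arcs Q. \<not> arrow_product_in Q I a b}"
      using a arrow_product_in_iff by blast
    from card_mono[OF _ this] lg.nonrel_right[OF a]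
    show "card {b \<in> arcs Q. head Q a = tail Q b \<and> \<not> zero_pair a b} \<le> 1" by simp
  qed
  moreover have "?den \<noteq> 0"
  proof -
    have "1 - fps_X ^ cycle_length C \<noteq> (0 :: int fps)" if C: "C \<in> nonzero_cycles Q I" for C
    proof -
      obtain p where p: "C = rotation_rel `` {p}"
        "p \<in> simple_cycles (\<lambda>a b. head Q a = tail Q b \<and> \<not> zero_pair a b) (arcs Q)"
        using C[unfolded minimal_cycles_arrow_product_in] by (auto elim: quotientE)
      then have "p \<noteq> []" by (simp add: simple_cycles_def)
      \<comment> \<open>Cycles are nonempty, so the constant coefficient is \<open>1\<close> and not \<open>1 - 1\<close>.\<close>
      with p(1) have "fps_nth (1 - fps_X ^ cycle_length C :: int fps) 0 = 1"
        by (simp add: cycle_length_rotation_class fps_X_power_nth)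
      then show ?thesis by (metis fps_zero_nth zero_neq_one)
    qed
    then show ?thesis
      by (cases "finite (nonzero_cycles Q I)") auto
  qed
  ultimately show ?thesis
    by (simp add: nonzero_eq_divide_eq flip: to_fract_mult)
qed

end
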